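(* Let $\{x^k\}_{k\ge 0}$ be the random sequence generated by the RBPDN method (described in the context) from the initial point $x^0\in\mathrm{dom}(F)$. Assume that $g$ is Lipschitz continuous in $\mathcal{S}(x^0):=\{x: F(x)\le F(x^0)\}$. Then $$\lim_{k\to\infty}\mathbf{E}[F(x^k)]=F^*.$$
   Context: Problem and standing assumptions. Consider $F^*=\min_{x\in\mathbb{R}^N}\{F(x):=f(x)+g(x)\}$, where $f,g:\mathbb{R}^N\to\mathbb{R}\cup\{\infty\}$. The components of $x\in\mathbb{R}^N$ are partitioned into subvectors $x_1,\dots,x_n$ with $x_i\in\mathbb{R}^{N_i}$, and $g(x)=\sum_{i=1}^n g_i(x_i)$ with each $g_i:\mathbb{R}^{N_i}\to\mathbb{R}\cup\{\infty\}$ proper closed convex. The function $f$ is standard self-concordant: it is a closed convex function with open domain $\mathrm{dom}(f)$, three times continuously differentiable on $\mathrm{dom}(f)$, and $|\psi'''(0)|\le 2(\psi''(0))^{3/2}$ for all $x\in\mathrm{dom}(f)$, $u\in\mathbb{R}^N$, where $\psi(t)=f(x+tu)$. Also $\nabla^2 f$ is continuous and positive definite on $\mathrm{dom}(F)$, and the problem has a unique optimal solution $x^*$ (so $F^*=F(x^* )$). Notation. $\nabla_i f(x)$ is the subvector of $\nabla f(x)$, and $\nabla^2_{ii}f(x)$ the submatrix of $\nabla^2 f(x)$, corresponding to $x_i$. For $y,z\in\mathbb{R}^{N_i}$, $\|y\|_{x_i}:=\sqrt{\langle y,\nabla^2_{ii}f(x)y\rangle}$ and $\|z\|^*_{x_i}:=\sqrt{\langle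 z,(\nabla^2_{ii}f(x))^{-1}z\rangle}$. RBPDN method. Fix $x^0\in\mathrm{dom}(F)$, $\eta\in[0,1/4]$ and $p_1,\dots,p_n>0$ with $\sum_i p_i=1$. For each $x\in\mathrm{dom}(F)$ and each $i$, $d_i(x)\in\mathbb{R}^{N_i}$ denotes an approximate solution of $\min_{d_i}\{f(x)+\langle\nabla_i f(x),d_i\rangle+\frac12\langle d_i,\nabla^2_{ii}f(x)d_i\rangle+g_i(x_i+d_i)\}$ in the sense that, for some $v_i$, $-v_i\in\nabla_i f(x)+\nabla^2_{ii}f(x)d_i(x)+\partial g_i(x_i+d_i(x))$ and $\|v_i\|^*_{x_i}\le\eta\|d_i(x)\|_{x_i}$. Put $\lambda_i(x):=\|d_i(x)\|_{x_i}$. At iteration $k\ge0$, pick $\iota\in\{1,\dots,n\}$ at random (independently of the past) with probability $p_\iota$, and set $x^{k+1}_j=x^k_j$ for $j\ne\iota$ and $x^{k+1}_\iota=x^k_\iota+d_\iota(x^k)/(1+\lambda_\iota(x^k))$. $\mathbf{E}$ is expectation over all random block choices. *)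

theory Defs
  imports "HOL-Probability.Probability"
begin

(* Functions into the reals with infinity adjoined are ereal-valued functions that avoid
   minus infinity.  The set S is the space on which the function lives (all of R^N for f, one
   block space for g_i); values outside S are irrelevant. *)

definition edom :: "'a set \<Rightarrow> ('a \<Rightarrow> ereal) \<Rightarrow> 'a set" where
  "edom S h = {x \<in> S. h x < \<infinity>}"

definition eepigraph :: "'a set \<Rightarrow> ('a \<Rightarrow> ereal) \<Rightarrow> ('a \<times> real) set" where
  "eepigraph S h = {(x, r). x \<in> S \<and> h x \<le> ereal r}"

definition proper_on :: "'a set \<Rightarrow> ('a \<Rightarrow> ereal) \<Rightarrow> bool" where
  "proper_on S h \<longleftrightarrow> (\<forall>x\<in>S. h x \<noteq> -\<infinity>) \<and> edom S h \<noteq> {}"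

definition closed_convex_on :: "'a::euclidean_space set \<Rightarrow> ('a \<Rightarrow> ereal) \<Rightarrow> bool" where
  "closed_convex_on S h \<longleftrightarrow> closed (eepigraph S h) \<and> convex (eepigraph S h)"

(* For proper h this is empty at points outside the effective domain, as usual. *)
definition subdiff_on :: "'a::euclidean_space set \<Rightarrow> ('a \<Rightarrow> ereal) \<Rightarrow> 'a \<Rightarrow> 'a set" where
  "subdiff_on S h y = {s \<in> S. \<forall>z\<in>S. h y + ereal (s \<bullet> (z - y)) \<le> h z}"

definition grad :: "(real^'n \<Rightarrow> real) \<Rightarrow> real^'n \<Rightarrow> real^'n" where
  "grad \<phi> x = (\<chi> j. frechet_derivative \<phi> (at x) (axis j 1))"

definition hess :: "(real^'n \<Rightarrow> real) \<Rightarrow> real^'n \<Rightarrow> real^'n^'n" where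
  "hess \<phi> x = jacobian (grad \<phi>) (at x)"

definition pos_def :: "real^'n^'n \<Rightarrow> bool" where
  "pos_def A \<longleftrightarrow> transpose A = A \<and> (\<forall>u. u \<noteq> 0 \<longrightarrow> 0 < u \<bullet> (A *v u))"

(* k times continuously differentiable on S, for open S. *)
primrec times_cont_diff_on :: "nat \<Rightarrow> ('a::euclidean_space \<Rightarrow> real) \<Rightarrow> 'a set \<Rightarrow> bool" where
  "times_cont_diff_on 0 \<phi> S \<longleftrightarrow> continuous_on S \<phi>"
| "times_cont_diff_on (Suc k) \<phi> S \<longleftrightarrow>
     (\<forall>x\<in>S. \<phi> differentiable (at x)) \<and>
     (\<forall>u. times_cont_diff_on k (\<lambda>x. frechet_derivative \<phi> (at x) u) S)"

(* The real-valued restriction of an extended-valued function; only its values on the (open)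
   effective domain matter. *)
definition fin :: "('a \<Rightarrow> ereal) \<Rightarrow> 'a \<Rightarrow> real" where
  "fin h x = real_of_ereal (h x)"

definition standard_self_concordant :: "('a::euclidean_space \<Rightarrow> ereal) \<Rightarrow> bool" where
  "standard_self_concordant f \<longleftrightarrow>
     (\<forall>x. f x \<noteq> -\<infinity>) \<and> closed_convex_on UNIV f \<and> open (edom UNIV f) \<and>
     times_cont_diff_on 3 (fin f) (edom UNIV f) \<and>
     (\<forall>x\<in>edom UNIV f. \<forall>u.
        let \<psi> = (\<lambda>t::real. fin f (x + t *\<^sub>R u))
        in \<bar>(deriv ^^ 3) \<psi> 0\<bar> \<le> 2 * ((deriv ^^ 2) \<psi> 0) powr (3/2))"

(* The partition of the N components into n blocks is a map blk :: 'n => 'b from component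
   indices to block labels, with N = CARD('n) and n = CARD('b).  The factor R^{N_i} is the
   coordinate subspace block_space blk i of R^N; a subvector is the vector of that subspace
   obtained by setting the components of the other blocks to zero.  Likewise the (i,i) block
   of a matrix is padded with zeros. *)

definition block_space :: "('n \<Rightarrow> 'b) \<Rightarrow> 'b \<Rightarrow> (real^'n) set" where
  "block_space blk i = {y. \<forall>j. blk j \<noteq> i \<longrightarrow> y $ j = 0}"

definition subvec :: "('n \<Rightarrow> 'b) \<Rightarrow> 'b \<Rightarrow> real^'n \<Rightarrow> real^'n" where
  "subvec blk i x = (\<chi> j. if blk j = i then x $ j else 0)"

definition submat :: "('n \<Rightarrow> 'b) \<Rightarrow> 'b \<Rightarrow> real^'n^'n \<Rightarrow> real^'n^'n" where
  "submat blk i A = (\<chi> j l. if blk j = i \<and> blk l = i then A $ j $ l else 0)"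

definition block_grad :: "(real^'n \<Rightarrow> ereal) \<Rightarrow> ('n \<Rightarrow> 'b) \<Rightarrow> 'b \<Rightarrow> real^'n \<Rightarrow> real^'n" where
  "block_grad f blk i x = subvec blk i (grad (fin f) x)"

definition block_hess :: "(real^'n \<Rightarrow> ereal) \<Rightarrow> ('n \<Rightarrow> 'b) \<Rightarrow> 'b \<Rightarrow> real^'n \<Rightarrow> real^'n^'n" where
  "block_hess f blk i x = submat blk i (hess (fin f) x)"

(* The padded block is singular on R^N; it is inverted as an operator on the block space. *)
definition block_hess_inv :: "(real^'n \<Rightarrow> ereal) \<Rightarrow> ('n \<Rightarrow> 'b) \<Rightarrow> 'b \<Rightarrow> real^'n \<Rightarrow> real^'n \<Rightarrow> real^'n" where
  "block_hess_inv f blk i x z = inv_into (block_space blk i) ((*v) (block_hess f blk i x)) z"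

definition local_norm :: "(real^'n \<Rightarrow> ereal) \<Rightarrow> ('n \<Rightarrow> 'b) \<Rightarrow> 'b \<Rightarrow> real^'n \<Rightarrow> real^'n \<Rightarrow> real" where
  "local_norm f blk i x y = sqrt (y \<bullet> (block_hess f blk i x *v y))"

definition local_dual_norm :: "(real^'n \<Rightarrow> ereal) \<Rightarrow> ('n \<Rightarrow> 'b) \<Rightarrow> 'b \<Rightarrow> real^'n \<Rightarrow> real^'n \<Rightarrow> real" where
  "local_dual_norm f blk i x z = sqrt (z \<bullet> block_hess_inv f blk i x z)"

definition block_sep :: "('n \<Rightarrow> 'b::finite) \<Rightarrow> ('b \<Rightarrow> real^'n \<Rightarrow> ereal) \<Rightarrow> real^'n \<Rightarrow> ereal" where
  "block_sep blk gs x = (\<Sum>i\<in>UNIV. gs i (subvec blk i x))"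

definition objective ::
  "(real^'n \<Rightarrow> ereal) \<Rightarrow> ('n \<Rightarrow> 'b::finite) \<Rightarrow> ('b \<Rightarrow> real^'n \<Rightarrow> ereal) \<Rightarrow> real^'n \<Rightarrow> ereal" where
  "objective f blk gs x = f x + block_sep blk gs x"

definition approx_direction ::
  "(real^'n \<Rightarrow> ereal) \<Rightarrow> ('n \<Rightarrow> 'b) \<Rightarrow> ('b \<Rightarrow> real^'n \<Rightarrow> ereal) \<Rightarrow> real \<Rightarrow>
   'b \<Rightarrow> real^'n \<Rightarrow> real^'n \<Rightarrow> bool" where
  "approx_direction f blk gs \<eta> i x d \<longleftrightarrow>
     d \<in> block_space blk i \<and>
     (\<exists>v\<in>block_space blk i.
        - v \<in> (\<lambda>s. block_grad f blk i x + block_hess f blk i x *v d + s) `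
               subdiff_on (block_space blk i) (gs i) (subvec blk i x + d) \<and>
        local_dual_norm f blk i x v \<le> \<eta> * local_norm f blk i x d)"

definition rbpdn_step ::
  "(real^'n \<Rightarrow> ereal) \<Rightarrow> ('n \<Rightarrow> 'b) \<Rightarrow> ('b \<Rightarrow> real^'n \<Rightarrow> real^'n) \<Rightarrow> 'b \<Rightarrow> real^'n \<Rightarrow> real^'n" where
  "rbpdn_step f blk d i x =
     (\<chi> j. if blk j = i then x $ j + d i x $ j / (1 + local_norm f blk i x (d i x)) else x $ j)"

(* c k is the block picked at iteration k. *)
primrec rbpdn ::
  "(real^'n \<Rightarrow> ereal) \<Rightarrow> ('n \<Rightarrow> 'b) \<Rightarrow> ('b \<Rightarrow> real^'n \<Rightarrow> real^'n) \<Rightarrow> real^'n \<Rightarrow>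
   (nat \<Rightarrow> 'b) \<Rightarrow> nat \<Rightarrow> real^'n" where
  "rbpdn f blk d x0 c 0 = x0"
| "rbpdn f blk d x0 c (Suc k) = rbpdn_step f blk d (c k) (rbpdn f blk d x0 c k)"

(* Expectation of an extended-valued random variable, positive part minus negative part
   (e2ennreal sends negative arguments to 0).  An infinite value on a set of positive
   probability is not discarded, as it would be after conversion to real. *)
definition ereal_expectation :: "'w measure \<Rightarrow> ('w \<Rightarrow> ereal) \<Rightarrow> ereal" where
  "ereal_expectation M Y =
     enn2ereal (\<integral>\<^sup>+ \<omega>. e2ennreal (Y \<omega>) \<partial>M) - enn2ereal (\<integral>\<^sup>+ \<omega>. e2ennreal (- Y \<omega>) \<partial>M)"

end

theory Submission
  imports Defs
begin

text \<open>
  Why the theorem holds. The expected optimality gap is compared with the expected decrease of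
  one iteration; the decreases are summable, so the gap must vanish.

  Decrease. Along a line \<open>\<psi>(t) = f(x + t u)\<close>, self-concordance says that \<open>\<psi>'' powr (-1/2)\<close> has slope at
  least minus one, so \<open>\<psi>''(t) \<le> (l / (1 - l t))\<^sup>2\<close> for \<open>l = sqrt (\<psi>''(0))\<close>. Two
  integrations bound \<open>f\<close> from above, and since \<open>f\<close> is closed this bound also keeps the
  segment in the domain as long as \<open>l t < 1\<close> (\<open>self_concordant_directional_bound\<close>). The
  damped step length \<open>1 / (1 + l)\<close> satisfies that restriction, and the inexact optimality
  condition on the direction together with convexity of the block of \<open>g\<close> turns the bound into a
  decrease of at least \<open>l\<^sup>2 / (4 (1 + l))\<close>, where \<open>l = \<lambda>\<^sub>i(x)\<close> (\<open>step_decrease\<close>).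

  Gap. The sublevel set of the initial point is compact, because a closed convex function with
  a unique minimizer has bounded sublevel sets. On it the Hessian is uniformly positive
  definite and bounded, so small \<open>\<lambda>\<^sub>i(x)\<close> means small directions \<open>d\<^sub>i(x)\<close>. Adding
  the inexact optimality conditions of all blocks and the gradient inequality for \<open>f\<close> bounds
  \<open>F(x) - F*\<close> by \<open>g(x) - g(x + d(x))\<close> plus a multiple of the sum of the \<open>\<lambda>\<^sub>i(x)\<close>. The
  point \<open>x + d(x)\<close> may leave the sublevel set; there lower semicontinuity of \<open>g\<close>, made uniform
  by compactness and by the continuity of \<open>g\<close> on the sublevel set, bounds the difference.
  Hence for every \<open>\<epsilon> > 0\<close> there is \<open>K\<close> such that the gap at every point of the sublevel
  set is at most \<open>\<epsilon>\<close> plus \<open>K\<close> times the guaranteed decrease, averaged over the random block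
  (\<open>gap_le_expected_decrease\<close>).

  Conclusion. With \<open>a\<^sub>k\<close> the expected value after \<open>k\<close> iterations, independence of
  the next block from the past gives \<open>a\<^sub>k - F* \<le> \<epsilon> + K (a\<^sub>k - a\<^sub>k\<^sub>+\<^sub>1)\<close>. The sequence
  decreases and is bounded below by \<open>F*\<close>, so the last difference tends to zero and the limit
  is at most \<open>F* + \<epsilon>\<close> for every \<open>\<epsilon>\<close> (\<open>tendsto_of_gap_le_decrease\<close>).
\<close>

section \<open>Self-concordant functions of one variable\<close>

text \<open>
  Where \<open>h2\<close> is positive, the bound on its derivative says that \<open>h2 powr (-1/2)\<close> has
  derivative at least \<open>-1\<close>. As \<open>h2\<close> may vanish, the argument is applied to \<open>h2 + \<epsilon>\<close>, for which it
  gives an inequality without denominators that survives the limit \<open>\<epsilon> \<rightarrow> 0\<close>.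
\<close>
lemma self_concordant_sqrt_growth:
  fixes h2 h3 :: "real \<Rightarrow> real"
  assumes T: "0 \<le> T" and l: "sqrt (h2 0) * T < 1"
    and der: "\<And>t. 0 \<le> t \<Longrightarrow> t \<le> T \<Longrightarrow> (h2 has_real_derivative h3 t) (at t)"
    and nonneg: "\<And>t. 0 \<le> t \<Longrightarrow> t \<le> T \<Longrightarrow> 0 \<le> h2 t"
    and sc: "\<And>t. 0 \<le> t \<Longrightarrow> t \<le> T \<Longrightarrow> \<bar>h3 t\<bar> \<le> 2 * h2 t powr (3/2)"
  shows "sqrt (h2 T) \<le> sqrt (h2 0) / (1 - sqrt (h2 0) * T)"
proof -
  have perturbed: "sqrt (h2 T + \<epsilon>) \<le> sqrt (h2 0 + \<epsilon>) * (1 + T * sqrt (h2 T + \<epsilon>))"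
    if e: "0 < \<epsilon>" for \<epsilon>
  proof -
    define r where "r t = (h2 t + \<epsilon>) powr (-1/2) + t" for t
    have "r 0 \<le> r T"
    proof (rule DERIV_nonneg_imp_nondecreasing[OF T])
      fix t assume t: "0 \<le> t" "t \<le> T"
      have pos: "0 < h2 t + \<epsilon>" using nonneg[OF t] e by simp
      have "(r has_real_derivative ((-1/2) * (h2 t + \<epsilon>) powr (-1/2 - 1) * h3 t + 1)) (at t)"
        unfolding r_def using der[OF t] pos
        by (auto intro!: derivative_eq_intros simp: powr_diff)
      moreover have "0 \<le> (-1/2) * (h2 t + \<epsilon>) powr (-1/2 - 1) * h3 t + 1"
      proof -
        have "h3 t \<le> 2 * h2 t powr (3/2)" using sc[OF t] by simp
        also have "\<dots> \<le> 2 * (h2 t + \<epsilon>) powr (3/2)"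
          using nonneg[OF t] e by (intro mult_left_mono powr_mono2) auto
        finally have "(h2 t + \<epsilon>) powr (-3/2) * h3 t \<le> (h2 t + \<epsilon>) powr (-3/2) * (2 * (h2 t + \<epsilon>) powr (3/2))"
          by (intro mult_left_mono) auto
        also have "\<dots> = 2" using pos by (simp add: powr_minus field_simps)
        finally show ?thesis by simp
      qed
      ultimately show "\<exists>y. (r has_real_derivative y) (at t) \<and> 0 \<le> y" by blast
    qed
    moreover have "(h2 t + \<epsilon>) powr (-1/2) = 1 / sqrt (h2 t + \<epsilon>)" if "0 \<le> t" "t \<le> T" for t
      using nonneg[OF that] e by (simp add: powr_minus powr_half_sqrt field_simps)
    ultimately have "1 / sqrt (h2 0 + \<epsilon>) \<le> 1 / sqrt (h2 T + \<epsilon>) + T"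
      using T unfolding r_def by simp
    moreover have "0 < sqrt (h2 0 + \<epsilon>)" "0 < sqrt (h2 T + \<epsilon>)"
      using nonneg[of 0] nonneg[of T] T e by auto
    ultimately show ?thesis by (simp add: field_simps)
  qed
  have "sqrt (h2 T + 0) \<le> sqrt (h2 0 + 0) * (1 + T * sqrt (h2 T + 0))"
  proof (rule tendsto_le[of "at_right (0::real)"])
    show "((\<lambda>\<epsilon>. sqrt (h2 0 + \<epsilon>) * (1 + T * sqrt (h2 T + \<epsilon>))) \<longlongrightarrow>
        sqrt (h2 0 + 0) * (1 + T * sqrt (h2 T + 0))) (at_right 0)"
      by (intro tendsto_intros)
    show "((\<lambda>\<epsilon>. sqrt (h2 T + \<epsilon>)) \<longlongrightarrow> sqrt (h2 T + 0)) (at_right 0)"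
      by (intro tendsto_intros)
    show "\<forall>\<^sub>F \<epsilon> in at_right 0. sqrt (h2 T + \<epsilon>) \<le> sqrt (h2 0 + \<epsilon>) * (1 + T * sqrt (h2 T + \<epsilon>))"
      using perturbed by (auto simp: eventually_at_right_less eventually_at_filter)
  qed simp
  thus ?thesis using l by (simp add: field_simps)
qed

text \<open>
  The upper bound is the function with the same value and slope at \<open>0\<close> whose second
  derivative is \<open>(l / (1 - l t))\<^sup>2\<close>, the largest one allowed by the growth estimate;
  comparing derivatives twice gives the claim.
\<close>
lemma self_concordant_line_upper_bound:
  fixes h h1 h2 h3 :: "real \<Rightarrow> real"
  assumes T: "0 \<le> T" and l: "sqrt (h2 0) * T < 1"
    and der1: "\<And>t. 0 \<le> t \<Longrightarrow> t \<le> T \<Longrightarrow> (h has_real_derivative h1 t) (at t)"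
    and der2: "\<And>t. 0 \<le> t \<Longrightarrow> t \<le> T \<Longrightarrow> (h1 has_real_derivative h2 t) (at t)"
    and der3: "\<And>t. 0 \<le> t \<Longrightarrow> t \<le> T \<Longrightarrow> (h2 has_real_derivative h3 t) (at t)"
    and nonneg: "\<And>t. 0 \<le> t \<Longrightarrow> t \<le> T \<Longrightarrow> 0 \<le> h2 t"
    and sc: "\<And>t. 0 \<le> t \<Longrightarrow> t \<le> T \<Longrightarrow> \<bar>h3 t\<bar> \<le> 2 * h2 t powr (3/2)"
  shows "h T \<le> h 0 + h1 0 * T - sqrt (h2 0) * T - ln (1 - sqrt (h2 0) * T)"
proof -
  define l where "l = sqrt (h2 0)"
  have l0: "0 \<le> l" using nonneg[of 0] T by (simp add: l_def)
  have lt: "l * t < 1" if "0 \<le> t" "t \<le> T" for t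
    using mult_left_mono[OF that(2) l0] assms(2) by (simp add: l_def)
  have h2_le: "h2 t \<le> (l / (1 - l * t))\<^sup>2" if t: "0 \<le> t" "t \<le> T" for t
  proof -
    have "sqrt (h2 t) \<le> l / (1 - l * t)"
      unfolding l_def
      by (rule self_concordant_sqrt_growth[where ?h3.0 = h3])
        (use t lt[OF t] der3 nonneg sc in \<open>auto simp: l_def\<close>)
    hence "(sqrt (h2 t))\<^sup>2 \<le> (l / (1 - l * t))\<^sup>2" using nonneg[OF t] by (intro power_mono) auto
    thus ?thesis using nonneg[OF t] by simp
  qed
  have h1_le: "h1 t \<le> h1 0 + l / (1 - l * t) - l" if t: "0 \<le> t" "t \<le> T" for t
  proof -
    have "(\<lambda>s. l / (1 - l * s) - h1 s) 0 \<le> (\<lambda>s. l / (1 - l * s) - h1 s) t"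
    proof (rule DERIV_nonneg_imp_nondecreasing[OF t(1)])
      fix s assume "0 \<le> s" "s \<le> t"
      hence s: "0 \<le> s" "s \<le> T" using t by auto
      have "((\<lambda>s. l / (1 - l * s) - h1 s) has_real_derivative ((l / (1 - l * s))\<^sup>2 - h2 s)) (at s)"
        using der2[OF s] lt[OF s]
        by (auto intro!: derivative_eq_intros simp: power2_eq_square)
      thus "\<exists>y. ((\<lambda>s. l / (1 - l * s) - h1 s) has_real_derivative y) (at s) \<and> 0 \<le> y"
        using h2_le[OF s] by force
    qed
    thus ?thesis by simp
  qed
  have "(\<lambda>t. h1 0 * t - l * t - ln (1 - l * t) - h t) 0 \<le> (\<lambda>t. h1 0 * t - l * t - ln (1 - l * t) - h t) T"
  proof (rule DERIV_nonneg_imp_nondecreasing[OF T])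
    fix s assume s: "0 \<le> s" "s \<le> T"
    have "((\<lambda>t. h1 0 * t - l * t - ln (1 - l * t) - h t) has_real_derivative
        (h1 0 - l + l / (1 - l * s) - h1 s)) (at s)"
      using der1[OF s] lt[OF s] by (auto intro!: derivative_eq_intros)
    thus "\<exists>y. ((\<lambda>t. h1 0 * t - l * t - ln (1 - l * t) - h t) has_real_derivative y) (at s) \<and> 0 \<le> y"
      using h1_le[OF s] by force
  qed
  thus ?thesis by (simp add: l_def)
qed

section \<open>Self-concordant functions on Euclidean space\<close>

text \<open>
  With the direction as first argument, iterated directional derivatives are iterates of
  \<open>dir_deriv u\<close>; the smoothness hypothesis on \<open>f\<close> is a statement about these.
\<close>
definition dir_deriv :: "'a::real_normed_vector \<Rightarrow> ('a \<Rightarrow> real) \<Rightarrow> 'a \<Rightarrow> real" where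
  "dir_deriv u \<phi> x = frechet_derivative \<phi> (at x) u"

lemma has_real_derivative_along_line:
  fixes \<phi> :: "'a::real_normed_vector \<Rightarrow> real"
  assumes "\<phi> differentiable (at (x + t *\<^sub>R u))"
  shows "((\<lambda>t. \<phi> (x + t *\<^sub>R u)) has_real_derivative dir_deriv u \<phi> (x + t *\<^sub>R u)) (at t)"
proof -
  let ?D = "frechet_derivative \<phi> (at (x + t *\<^sub>R u))"
  have D: "(\<phi> has_derivative ?D) (at (x + t *\<^sub>R u))"
    using assms frechet_derivative_works by blast
  have "((\<lambda>t. x + t *\<^sub>R u) has_derivative (\<lambda>s. s *\<^sub>R u)) (at t)"
    by (auto intro!: derivative_eq_intros)
  from has_derivative_compose[OF this D]
  have "((\<lambda>t. \<phi> (x + t *\<^sub>R u)) has_derivative (\<lambda>s. ?D (s *\<^sub>R u))) (at t)" .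
  moreover have "?D (s *\<^sub>R u) = dir_deriv u \<phi> (x + t *\<^sub>R u) * s" for s
    using linear_frechet_derivative[OF assms] by (simp add: linear_cmul dir_deriv_def mult.commute)
  ultimately show ?thesis by (simp add: has_field_derivative_def)
qed

lemma open_line_preimage:
  fixes D :: "'a::real_normed_vector set"
  assumes "open D" shows "open {t::real. x + t *\<^sub>R u \<in> D}"
  using open_vimage[OF assms, of "\<lambda>t. x + t *\<^sub>R u"]
  by (simp add: vimage_def continuous_intros)

lemma edom_imp_ereal_fin:
  assumes "\<And>x. x \<in> S \<Longrightarrow> h x \<noteq> -\<infinity>" "x \<in> edom S h"
  shows "h x = ereal (fin h x)"
  using assms by (cases "h x") (auto simp: edom_def fin_def)

lemma convex_on_fin:
  fixes h :: "'a::euclidean_space \<Rightarrow> ereal"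
  assumes cc: "closed_convex_on S h" and nm: "\<And>x. x \<in> S \<Longrightarrow> h x \<noteq> -\<infinity>"
  shows "convex_on (edom S h) (fin h)"
proof -
  have key: "u *\<^sub>R x + v *\<^sub>R y \<in> edom S h \<and> fin h (u *\<^sub>R x + v *\<^sub>R y) \<le> u * fin h x + v * fin h y"
    if "x \<in> edom S h" "y \<in> edom S h" "0 \<le> u" "0 \<le> v" "u + v = 1" for x y u v
  proof -
    have "(x, fin h x) \<in> eepigraph S h" "(y, fin h y) \<in> eepigraph S h"
      using edom_imp_ereal_fin[OF nm that(1)] edom_imp_ereal_fin[OF nm that(2)] that(1,2)
      by (auto simp: eepigraph_def edom_def)
    hence "u *\<^sub>R (x, fin h x) + v *\<^sub>R (y, fin h y) \<in> eepigraph S h"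
      using cc that unfolding closed_convex_on_def convex_def by blast
    hence e: "u *\<^sub>R x + v *\<^sub>R y \<in> S" "h (u *\<^sub>R x + v *\<^sub>R y) \<le> ereal (u * fin h x + v * fin h y)"
      by (auto simp: eepigraph_def)
    hence d: "u *\<^sub>R x + v *\<^sub>R y \<in> edom S h" by (auto simp: edom_def less_eq_ereal_def)
    thus ?thesis using e(2) edom_imp_ereal_fin[OF nm d] by simp
  qed
  thus ?thesis unfolding convex_on_def convex_def by blast
qed

lemma convex_on_along_line:
  assumes "convex_on D \<phi>"
  shows "convex_on {t::real. x + t *\<^sub>R u \<in> D} (\<lambda>t. \<phi> (x + t *\<^sub>R u))"
proof -
  have eq: "x + (a * s + b * t) *\<^sub>R u = a *\<^sub>R (x + s *\<^sub>R u) + b *\<^sub>R (x + t *\<^sub>R u)"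
    if "a + b = 1" for a b s t :: real
  proof -
    have "a *\<^sub>R (x + s *\<^sub>R u) + b *\<^sub>R (x + t *\<^sub>R u) = (a + b) *\<^sub>R x + (a * s + b * t) *\<^sub>R u"
      by (simp add: algebra_simps)
    thus ?thesis using that by simp
  qed
  show ?thesis using assms unfolding convex_on_def convex_def by (auto simp: eq)
qed

text \<open>
  The tangent inequality at two points, added up, shows that the derivative is monotone.
\<close>
lemma convex_on_imp_second_derivative_nonneg:
  fixes h :: "real \<Rightarrow> real"
  assumes conv: "convex_on I h" and I: "open I"
    and der1: "\<And>t. t \<in> I \<Longrightarrow> (h has_real_derivative h1 t) (at t)"
    and der2: "(h1 has_real_derivative c) (at t)" and t: "t \<in> I"
  shows "0 \<le> c"
proof (rule mono_on_imp_deriv_nonneg[OF _ der2])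
  have conn: "connected I" using conv by (simp add: convex_on_def convex_connected)
  have tangent: "h1 s * (r - s) \<le> h r - h s" if "s \<in> I" "r \<in> I" for s r
    using convex_on_imp_above_tangent[OF conv conn _ that(2), of s "h1 s"] that I
    by (auto simp: interior_open intro: has_field_derivative_at_within der1)
  show "mono_on I h1"
  proof (rule mono_onI)
    fix r s assume rs: "r \<in> I" "s \<in> I" "r \<le> s"
    have "0 \<le> (h1 s - h1 r) * (s - r)"
      using tangent[OF rs(1,2)] tangent[OF rs(2,1)] by (simp add: algebra_simps)
    thus "h1 r \<le> h1 s" using rs by (cases "r = s") (auto simp: zero_le_mult_iff)
  qed
  show "t \<in> interior I" using t I by (simp add: interior_open)
qed

lemma self_concordant_line_derivatives:
  assumes sc: "standard_self_concordant f"
  defines "\<phi> \<equiv> fin f" and "D \<equiv> edom UNIV f"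
  assumes x: "x + t *\<^sub>R u \<in> D"
  shows "((\<lambda>t. \<phi> (x + t *\<^sub>R u)) has_real_derivative dir_deriv u \<phi> (x + t *\<^sub>R u)) (at t)"
    and "((\<lambda>t. dir_deriv u \<phi> (x + t *\<^sub>R u)) has_real_derivative dir_deriv u (dir_deriv u \<phi>) (x + t *\<^sub>R u)) (at t)"
    and "((\<lambda>t. dir_deriv u (dir_deriv u \<phi>) (x + t *\<^sub>R u)) has_real_derivative
            dir_deriv u (dir_deriv u (dir_deriv u \<phi>)) (x + t *\<^sub>R u)) (at t)"
proof -
  have "times_cont_diff_on 3 \<phi> D" using sc by (simp add: standard_self_concordant_def \<phi>_def D_def)
  hence "\<And>y. y \<in> D \<Longrightarrow> \<phi> differentiable (at y)"
    "\<And>y u. y \<in> D \<Longrightarrow> dir_deriv u \<phi> differentiable (at y)"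
    "\<And>y u v. y \<in> D \<Longrightarrow> dir_deriv v (dir_deriv u \<phi>) differentiable (at y)"
    by (auto simp: numeral_3_eq_3 dir_deriv_def[abs_def])
  thus "((\<lambda>t. \<phi> (x + t *\<^sub>R u)) has_real_derivative dir_deriv u \<phi> (x + t *\<^sub>R u)) (at t)"
    "((\<lambda>t. dir_deriv u \<phi> (x + t *\<^sub>R u)) has_real_derivative dir_deriv u (dir_deriv u \<phi>) (x + t *\<^sub>R u)) (at t)"
    "((\<lambda>t. dir_deriv u (dir_deriv u \<phi>) (x + t *\<^sub>R u)) has_real_derivative
            dir_deriv u (dir_deriv u (dir_deriv u \<phi>)) (x + t *\<^sub>R u)) (at t)"
    using x by (auto intro!: has_real_derivative_along_line)
qed

lemma deriv_eq_on_open: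
  fixes I :: "real set"
  assumes "open I" "\<And>t. t \<in> I \<Longrightarrow> g t = h t" "\<And>t. t \<in> I \<Longrightarrow> (h has_real_derivative h' t) (at t)" "t \<in> I"
  shows "deriv g t = h' t"
proof -
  have "deriv g t = deriv h t"
    by (rule deriv_cong_ev) (use assms eventually_nhds in blast)+
  thus ?thesis using assms DERIV_imp_deriv by metis
qed

text \<open>
  The definition of self-concordance concerns iterated \<open>deriv\<close> of a line restriction at
  \<open>0\<close>. An iterated \<open>deriv\<close> depends on a neighbourhood of the point, so each order is
  identified on the whole open set of parameters at which the line is in the domain.
\<close>
lemma self_concordant_third_derivative:
  assumes sc: "standard_self_concordant f" and x: "x \<in> edom UNIV f"
  shows "\<bar>dir_deriv u (dir_deriv u (dir_deriv u (fin f))) x\<bar> \<le> 2 * dir_deriv u (dir_deriv u (fin f)) x powr (3/2)"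
proof -
  define \<psi> where "\<psi> t = fin f (x + t *\<^sub>R u)" for t :: real
  define I where "I = {t::real. x + t *\<^sub>R u \<in> edom UNIV f}"
  have I: "open I" using sc by (auto simp: I_def standard_self_concordant_def intro: open_line_preimage)
  have I0: "0 \<in> I" using x by (simp add: I_def)
  note der = self_concordant_line_derivatives[OF sc, of x _ u, folded \<psi>_def[abs_def]]
  have d1: "deriv \<psi> t = dir_deriv u (fin f) (x + t *\<^sub>R u)" if "t \<in> I" for t
    using der(1)[of t] that by (intro DERIV_imp_deriv) (simp add: I_def)
  have d2: "deriv (deriv \<psi>) t = dir_deriv u (dir_deriv u (fin f)) (x + t *\<^sub>R u)" if "t \<in> I" for t
    by (rule deriv_eq_on_open[OF I d1 _ that]) (use der(2) in \<open>simp_all add: I_def\<close>)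
  have d3: "deriv (deriv (deriv \<psi>)) t = dir_deriv u (dir_deriv u (dir_deriv u (fin f))) (x + t *\<^sub>R u)" if "t \<in> I" for t
    by (rule deriv_eq_on_open[OF I d2 _ that]) (use der(3) in \<open>simp_all add: I_def\<close>)
  have "\<bar>(deriv ^^ 3) \<psi> 0\<bar> \<le> 2 * ((deriv ^^ 2) \<psi> 0) powr (3/2)"
    using sc x unfolding standard_self_concordant_def Let_def \<psi>_def by blast
  thus ?thesis using d2[OF I0] d3[OF I0] by (simp add: numeral_3_eq_3 numeral_2_eq_2)
qed

lemma self_concordant_convex_on:
  assumes "standard_self_concordant f"
  shows "convex_on (edom UNIV f) (fin f)"
  using assms by (intro convex_on_fin) (auto simp: standard_self_concordant_def)

lemma self_concordant_second_derivative_nonneg: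
  assumes sc: "standard_self_concordant f" and x: "x \<in> edom UNIV f"
  shows "0 \<le> dir_deriv u (dir_deriv u (fin f)) x"
proof (rule convex_on_imp_second_derivative_nonneg)
  let ?I = "{t::real. x + t *\<^sub>R u \<in> edom UNIV f}"
  show "open ?I" using sc by (auto simp: standard_self_concordant_def intro: open_line_preimage)
  show "convex_on ?I (\<lambda>t. fin f (x + t *\<^sub>R u))"
    by (rule convex_on_along_line[OF self_concordant_convex_on[OF sc]])
  show "((\<lambda>t. fin f (x + t *\<^sub>R u)) has_real_derivative dir_deriv u (fin f) (x + t *\<^sub>R u)) (at t)"
    if "t \<in> ?I" for t
    using that by (intro self_concordant_line_derivatives[OF sc]) simp
  show "((\<lambda>t. dir_deriv u (fin f) (x + t *\<^sub>R u)) has_real_derivative dir_deriv u (dir_deriv u (fin f)) x) (at 0)"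
    using self_concordant_line_derivatives(2)[OF sc, of x 0 u] x by simp
  show "0 \<in> ?I" using x by simp
qed

text \<open>
  That the segment stays in the domain and that \<open>f\<close> obeys the bound are proved together: the
  bound holds up to any parameter in the domain and gives one constant \<open>C\<close> for all of them.
  So the parameters in \<open>{0..T}\<close> with the point in the domain form an open set, and also a
  closed one, namely the preimage of the closed epigraph at height \<open>C\<close>. As the interval is
  connected, this is all of it.
\<close>
lemma self_concordant_directional_bound:
  assumes sc: "standard_self_concordant f" and x: "x \<in> edom UNIV f"
    and T: "0 \<le> T" and l: "sqrt (dir_deriv u (dir_deriv u (fin f)) x) * T < 1"
  shows "x + T *\<^sub>R u \<in> edom UNIV f"
    and "fin f (x + T *\<^sub>R u) \<le> fin f x + dir_deriv u (fin f) x * T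
          - sqrt (dir_deriv u (dir_deriv u (fin f)) x) * T - ln (1 - sqrt (dir_deriv u (dir_deriv u (fin f)) x) * T)"
proof -
  define I where "I = {t::real. x + t *\<^sub>R u \<in> edom UNIV f}"
  define l where "l = sqrt (dir_deriv u (dir_deriv u (fin f)) x)"
  have I: "open I" using sc by (auto simp: I_def standard_self_concordant_def intro: open_line_preimage)
  have I0: "0 \<in> I" using x by (simp add: I_def)
  have convI: "convex I"
    using convex_on_along_line[OF self_concordant_convex_on[OF sc]] by (auto simp: I_def convex_on_def)
  have l0: "0 \<le> l" using self_concordant_second_derivative_nonneg[OF sc x] by (simp add: l_def)
  have lt: "l * t < 1" if "0 \<le> t" "t \<le> T" for t
    using mult_left_mono[OF that(2) l0] l that by (simp add: l_def)
  have bound: "fin f (x + t *\<^sub>R u) \<le> fin f x + dir_deriv u (fin f) x * t - l * t - ln (1 - l * t)"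
    if t: "0 \<le> t" "t \<le> T" "t \<in> I" for t
  proof -
    have seg: "s \<in> I" if "0 \<le> s" "s \<le> t" for s
      using convI I0 t(3) that unfolding is_interval_convex_1[symmetric] is_interval_1 by blast
    have "fin f (x + t *\<^sub>R u) \<le> fin f (x + 0 *\<^sub>R u) + dir_deriv u (fin f) (x + 0 *\<^sub>R u) * t
        - sqrt (dir_deriv u (dir_deriv u (fin f)) (x + 0 *\<^sub>R u)) * t
        - ln (1 - sqrt (dir_deriv u (dir_deriv u (fin f)) (x + 0 *\<^sub>R u)) * t)"
      by (rule self_concordant_line_upper_bound[where h = "\<lambda>t. fin f (x + t *\<^sub>R u)" and
            ?h1.0 = "\<lambda>t. dir_deriv u (fin f) (x + t *\<^sub>R u)" and
            ?h2.0 = "\<lambda>t. dir_deriv u (dir_deriv u (fin f)) (x + t *\<^sub>R u)" and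
            ?h3.0 = "\<lambda>t. dir_deriv u (dir_deriv u (dir_deriv u (fin f))) (x + t *\<^sub>R u)"])
        (use t lt[OF t(1,2)] seg in \<open>auto simp: l_def I_def intro!: self_concordant_line_derivatives[OF sc]
          self_concordant_second_derivative_nonneg[OF sc] self_concordant_third_derivative[OF sc]\<close>)
    thus ?thesis by (simp add: l_def)
  qed
  define C where "C = fin f x + \<bar>dir_deriv u (fin f) x\<bar> * T - ln (1 - l * T)"
  have unif: "fin f (x + t *\<^sub>R u) \<le> C" if t: "0 \<le> t" "t \<le> T" "t \<in> I" for t
  proof -
    have "dir_deriv u (fin f) x * t \<le> \<bar>dir_deriv u (fin f) x\<bar> * T"
      using t by (intro order.trans[OF mult_right_mono[OF abs_ge_self] mult_left_mono]) auto
    moreover have "ln (1 - l * T) \<le> ln (1 - l * t)"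
      using lt[of T] T mult_left_mono[OF t(2) l0] by simp
    moreover have "0 \<le> l * t" using l0 t by simp
    ultimately show ?thesis using bound[OF t] by (simp add: C_def)
  qed
  have nm: "f y \<noteq> -\<infinity>" for y using sc by (auto simp: standard_self_concordant_def)
  have fin_f: "f y = ereal (fin f y)" if "y \<in> edom UNIV f" for y
    by (rule edom_imp_ereal_fin[OF _ that]) (use nm in auto)
  have eq: "{0..T} \<inter> I = {0..T} \<inter> {t. (x + t *\<^sub>R u, C) \<in> eepigraph UNIV f}"
  proof -
    have "t \<in> I \<longleftrightarrow> (x + t *\<^sub>R u, C) \<in> eepigraph UNIV f" if t: "t \<in> {0..T}" for t
    proof
      assume tI: "t \<in> I"
      hence "f (x + t *\<^sub>R u) = ereal (fin f (x + t *\<^sub>R u))" by (intro fin_f) (simp add: I_def)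
      thus "(x + t *\<^sub>R u, C) \<in> eepigraph UNIV f" using unif[of t] t tI by (simp add: eepigraph_def)
    next
      assume "(x + t *\<^sub>R u, C) \<in> eepigraph UNIV f"
      thus "t \<in> I" by (auto simp: I_def edom_def eepigraph_def less_eq_ereal_def)
    qed
    thus ?thesis by blast
  qed
  have cont: "continuous_on UNIV (\<lambda>t. (x + t *\<^sub>R u, C))" by (intro continuous_intros)
  have "closed (eepigraph UNIV f)"
    using sc by (simp add: standard_self_concordant_def closed_convex_on_def)
  from closed_vimage[OF this cont] have "closed {t. (x + t *\<^sub>R u, C) \<in> eepigraph UNIV f}"
    by (simp add: vimage_def)
  hence "closedin (top_of_set {0..T}) ({0..T} \<inter> I)"
    unfolding eq closedin_closed by blast
  moreover have "openin (top_of_set {0..T}) ({0..T} \<inter> I)" using I by auto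
  ultimately have "{0..T} \<inter> I = {} \<or> {0..T} \<inter> I = {0..T}"
    using connected_clopen[THEN iffD1, OF connected_Icc[of 0 T], rule_format, of "{0..T} \<inter> I"] by metis
  moreover have "0 \<in> {0..T} \<inter> I" using T I0 by simp
  moreover have "T \<in> {0..T}" using T by simp
  ultimately have TI: "T \<in> I" by (metis IntD2 empty_iff)
  show "x + T *\<^sub>R u \<in> edom UNIV f" using TI by (simp add: I_def)
  show "fin f (x + T *\<^sub>R u) \<le> fin f x + dir_deriv u (fin f) x * T
          - sqrt (dir_deriv u (dir_deriv u (fin f)) x) * T - ln (1 - sqrt (dir_deriv u (dir_deriv u (fin f)) x) * T)"
    using bound[OF T order.refl TI] by (simp add: l_def)
qed

lemma dir_deriv_eq_grad:
  fixes \<phi> :: "real^'n \<Rightarrow> real"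
  assumes "\<phi> differentiable (at x)"
  shows "dir_deriv u \<phi> x = grad \<phi> x \<bullet> u"
proof -
  have lin: "linear (frechet_derivative \<phi> (at x))" by (rule linear_frechet_derivative[OF assms])
  have "dir_deriv u \<phi> x = frechet_derivative \<phi> (at x) (\<Sum>j\<in>UNIV. (u $ j) *\<^sub>R axis j 1)"
    using basis_expansion[of u] by (simp add: dir_deriv_def scalar_mult_eq_scaleR)
  also have "\<dots> = (\<Sum>j\<in>UNIV. u $ j * frechet_derivative \<phi> (at x) (axis j 1))"
    by (simp add: linear_sum[OF lin] linear_cmul[OF lin])
  also have "\<dots> = grad \<phi> x \<bullet> u" by (simp add: grad_def inner_vec_def mult.commute)
  finally show ?thesis .
qed

text \<open>
  The Hessian is the Jacobian of the gradient, so the gradient must be differentiable as a vector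
  function; this follows from its inner products with fixed vectors, which are the functions
  \<open>dir_deriv a \<phi>\<close> near \<open>x\<close>.
\<close>
lemma dir_deriv_dir_deriv_eq_hess:
  fixes \<phi> :: "real^'n \<Rightarrow> real"
  assumes D: "open D" "x \<in> D" and d1: "\<And>y. y \<in> D \<Longrightarrow> \<phi> differentiable (at y)"
    and d2: "\<And>u. dir_deriv u \<phi> differentiable (at x)"
  shows "dir_deriv u (dir_deriv u \<phi>) x = u \<bullet> (hess \<phi> x *v u)"
proof -
  have comp: "((\<lambda>y. grad \<phi> y \<bullet> a) has_derivative frechet_derivative (dir_deriv a \<phi>) (at x)) (at x)" for a
    by (rule has_derivative_transform_within_open[OF _ D, of "dir_deriv a \<phi>"])
      (use d2 frechet_derivative_works dir_deriv_eq_grad[OF d1] in \<open>auto\<close>)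
  have "grad \<phi> differentiable (at x)"
  proof -
    have "\<And>a. a \<in> Basis \<Longrightarrow> (\<lambda>y. grad \<phi> y \<bullet> a) differentiable (at x)"
      using comp differentiable_def by blast
    thus ?thesis using differentiable_componentwise_within[of "grad \<phi>" x UNIV] by blast
  qed
  hence "(grad \<phi> has_derivative (\<lambda>h. hess \<phi> x *v h)) (at x)"
    by (simp add: hess_def jacobian_works)
  hence "((\<lambda>y. grad \<phi> y \<bullet> u) has_derivative (\<lambda>h. (hess \<phi> x *v h) \<bullet> u)) (at x)"
    by (intro has_derivative_inner_left)
  hence "frechet_derivative (dir_deriv u \<phi>) (at x) = (\<lambda>h. (hess \<phi> x *v h) \<bullet> u)"
    using comp[of u] has_derivative_unique by blast
  thus ?thesis by (simp add: dir_deriv_def[of u "dir_deriv u \<phi>"] inner_commute)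
qed

lemma self_concordant_upper_bound:
  fixes f :: "real^'n \<Rightarrow> ereal"
  assumes sc: "standard_self_concordant f" and x: "x \<in> edom UNIV f"
    and l: "l = sqrt (u \<bullet> (hess (fin f) x *v u))" and T: "0 \<le> T" "l * T < 1"
  shows "x + T *\<^sub>R u \<in> edom UNIV f"
    and "fin f (x + T *\<^sub>R u) \<le> fin f x + (grad (fin f) x \<bullet> u) * T - l * T - ln (1 - l * T)"
proof -
  have D: "open (edom UNIV f)" and C3: "times_cont_diff_on 3 (fin f) (edom UNIV f)"
    using sc by (auto simp: standard_self_concordant_def)
  have d1: "fin f differentiable (at y)" if "y \<in> edom UNIV f" for y
    using C3 that by (simp add: numeral_3_eq_3)
  have d2: "dir_deriv v (fin f) differentiable (at x)" for v
    using C3 x by (simp add: numeral_3_eq_3 dir_deriv_def[abs_def])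
  have eqs: "dir_deriv u (fin f) x = grad (fin f) x \<bullet> u" "sqrt (dir_deriv u (dir_deriv u (fin f)) x) = l"
    using dir_deriv_eq_grad[OF d1[OF x]] dir_deriv_dir_deriv_eq_hess[OF D x d1 d2] l by auto
  show "x + T *\<^sub>R u \<in> edom UNIV f"
    "fin f (x + T *\<^sub>R u) \<le> fin f x + (grad (fin f) x \<bullet> u) * T - l * T - ln (1 - l * T)"
    using self_concordant_directional_bound[OF sc x T(1), of u] T(2) unfolding eqs by auto
qed

lemma self_concordant_gradient_inequality:
  fixes f :: "real^'n \<Rightarrow> ereal"
  assumes sc: "standard_self_concordant f" and x: "x \<in> edom UNIV f" and y: "y \<in> edom UNIV f"
  shows "fin f x + grad (fin f) x \<bullet> (y - x) \<le> fin f y"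
proof -
  define u where "u = y - x"
  let ?I = "{t::real. x + t *\<^sub>R u \<in> edom UNIV f}"
  have I: "open ?I" and d1: "fin f differentiable (at x)"
    using sc x by (auto simp: standard_self_concordant_def numeral_3_eq_3 intro: open_line_preimage)
  have conv: "convex_on ?I (\<lambda>t. fin f (x + t *\<^sub>R u))"
    by (rule convex_on_along_line[OF self_concordant_convex_on[OF sc]])
  have "dir_deriv u (fin f) x * (1 - 0) \<le> fin f (x + 1 *\<^sub>R u) - fin f (x + 0 *\<^sub>R u)"
  proof (rule convex_on_imp_above_tangent[OF conv])
    show "connected ?I" using conv by (simp add: convex_on_def convex_connected)
    show "0 \<in> interior ?I" using I x by (simp add: interior_open)
    show "1 \<in> ?I" using y by (simp add: u_def)
    show "((\<lambda>t. fin f (x + t *\<^sub>R u)) has_real_derivative dir_deriv u (fin f) x) (at 0 within ?I)"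
      using self_concordant_line_derivatives(1)[OF sc, of x 0 u] x
      by (auto intro: has_field_derivative_at_within)
  qed
  thus ?thesis using dir_deriv_eq_grad[OF d1, of u] by (simp add: u_def)
qed

lemma continuous_on_grad_self_concordant:
  fixes f :: "real^'n \<Rightarrow> ereal"
  assumes sc: "standard_self_concordant f"
  shows "continuous_on (edom UNIV f) (grad (fin f))"
proof -
  have "\<forall>y\<in>edom UNIV f. dir_deriv u (fin f) differentiable (at y)" for u
    using sc by (simp add: standard_self_concordant_def numeral_3_eq_3 dir_deriv_def[abs_def])
  hence "continuous_on (edom UNIV f) (dir_deriv u (fin f))" for u
    by (intro continuous_at_imp_continuous_on ballI differentiable_imp_continuous_within) blast
  thus ?thesis
    unfolding grad_def[abs_def] by (intro continuous_on_vec_lambda) (simp add: dir_deriv_def[abs_def])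
qed

section \<open>Positive definite matrices and their diagonal blocks\<close>

lemma pos_def_inner_commute:
  assumes "pos_def A"
  shows "x \<bullet> (A *v y) = y \<bullet> (A *v x)"
proof -
  have "x \<bullet> (A *v y) = (x v* A) \<bullet> y" by (simp add: dot_lmul_matrix)
  also have "x v* A = A *v x" using assms by (metis pos_def_def transpose_matrix_vector)
  finally show ?thesis by (simp add: inner_commute)
qed

lemma pos_def_nonneg: "pos_def A \<Longrightarrow> 0 \<le> u \<bullet> (A *v u)"
  by (cases "u = 0") (auto simp: pos_def_def less_imp_le)

text \<open>
  The form is nonnegative at \<open>u - t z\<close>; the choice of \<open>t\<close> minimizes its value there.
\<close>
lemma pos_def_Cauchy_Schwarz:
  assumes A: "pos_def A"
  shows "\<bar>u \<bullet> (A *v z)\<bar> \<le> sqrt (u \<bullet> (A *v u)) * sqrt (z \<bullet> (A *v z))"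
proof (cases "z = 0")
  case False
  define c where "c = z \<bullet> (A *v z)"
  define t where "t = u \<bullet> (A *v z) / c"
  have c: "0 < c" using A False by (simp add: pos_def_def c_def)
  have "0 \<le> (u - t *\<^sub>R z) \<bullet> (A *v (u - t *\<^sub>R z))" by (rule pos_def_nonneg[OF A])
  also have "\<dots> = u \<bullet> (A *v u) - 2 * t * (u \<bullet> (A *v z)) + t\<^sup>2 * c"
    using pos_def_inner_commute[OF A, of z u]
    by (simp add: matrix_vector_mult_diff_distrib matrix_vector_mult_scaleR inner_diff_left inner_diff_right
        c_def power2_eq_square algebra_simps)
  also have "\<dots> = u \<bullet> (A *v u) - (u \<bullet> (A *v z))\<^sup>2 / c"
    using c by (simp add: t_def power2_eq_square field_simps)
  finally have "(u \<bullet> (A *v z))\<^sup>2 \<le> (u \<bullet> (A *v u)) * c" using c by (simp add: field_simps)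
  hence "sqrt ((u \<bullet> (A *v z))\<^sup>2) \<le> sqrt ((u \<bullet> (A *v u)) * c)" by (rule real_sqrt_le_mono)
  thus ?thesis by (simp add: real_sqrt_mult c_def)
qed simp

lemma subvec_in_block_space [simp]: "subvec blk i x \<in> block_space blk i"
  by (simp add: subvec_def block_space_def)

lemma linear_subvec: "linear (subvec blk i)"
  by (rule linearI) (auto simp: subvec_def vec_eq_iff)

lemma subvec_eq_self: "y \<in> block_space blk i \<Longrightarrow> subvec blk i y = y"
  by (auto simp: subvec_def block_space_def vec_eq_iff)

lemma subvec_other_block: "y \<in> block_space blk i \<Longrightarrow> j \<noteq> i \<Longrightarrow> subvec blk j y = 0"
  by (auto simp: subvec_def block_space_def vec_eq_iff)

lemma subspace_block_space: "subspace (block_space blk i)"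
  by (auto simp: subspace_def block_space_def)

lemma sum_subvec: "(\<Sum>i\<in>UNIV. subvec blk i x) = x" for blk :: "'n::finite \<Rightarrow> 'b::finite"
  by (simp add: vec_eq_iff subvec_def sum_component)

lemma inner_subvec:
  assumes "y \<in> block_space blk i" shows "y \<bullet> subvec blk i w = y \<bullet> w"
  unfolding inner_vec_def using assms by (intro sum.cong) (auto simp: subvec_def block_space_def)

lemma norm_subvec_le: "norm (subvec blk i x) \<le> norm x"
  unfolding norm_vec_def by (rule L2_set_mono) (auto simp: subvec_def)

lemma submat_mult_vec:
  assumes "z \<in> block_space blk i"
  shows "submat blk i A *v z = subvec blk i (A *v z)"
  using assms unfolding matrix_vector_mult_def subvec_def submat_def block_space_def
  by (auto simp: vec_eq_iff intro!: sum.cong)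

lemma submat_in_block_space: "submat blk i A *v z \<in> block_space blk i"
  by (auto simp: submat_def block_space_def matrix_vector_mult_def)

lemma inner_submat_mult_vec:
  assumes "y \<in> block_space blk i" "z \<in> block_space blk i"
  shows "y \<bullet> (submat blk i A *v z) = y \<bullet> (A *v z)"
  by (simp add: submat_mult_vec[OF assms(2)] inner_subvec[OF assms(1)])

text \<open>
  The padded block vanishes on the other coordinates. Adding the projection to the other coordinates
  makes it injective, hence surjective, and the block components of a preimage under this sum
  form a preimage under the padded block.
\<close>
lemma submat_surj_on_block_space:
  assumes A: "pos_def A" and v: "v \<in> block_space blk i"
  shows "v \<in> (*v) (submat blk i A) ` block_space blk i"
proof -
  define T where "T w = submat blk i A *v subvec blk i w + (w - subvec blk i w)" for w
  have linT: "linear T" unfolding T_def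
    by (intro linear_compose_add linear_compose_sub linear_subvec linear_ident
        linear_compose[OF linear_subvec matrix_vector_mul_linear, unfolded o_def])
  have sub_T: "subvec blk i (T w) = submat blk i A *v subvec blk i w" for w
    unfolding T_def using linear_subvec[of blk i]
    by (simp add: linear_add linear_diff subvec_eq_self submat_in_block_space)
  have zero: "w = 0" if "T w = 0" for w
  proof -
    have "submat blk i A *v subvec blk i w = 0"
      using sub_T[of w] that linear_subvec[of blk i] by (simp add: linear_0)
    hence "subvec blk i w \<bullet> (A *v subvec blk i w) = 0"
      using inner_submat_mult_vec[of "subvec blk i w" blk i "subvec blk i w" A] by simp
    hence "subvec blk i w = 0" using A unfolding pos_def_def by force
    thus "w = 0" using that by (simp add: T_def matrix_vector_mult_0_right)
  qed
  hence "inj T" using linear_injective_0[OF linT] by blast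
  hence "surj T" using linear_injective_imp_surjective[OF linT] by blast
  then obtain w where w: "v = T w" by blast
  have "v = submat blk i A *v subvec blk i w"
    using sub_T[of w] subvec_eq_self[OF v] unfolding w[symmetric] by (rule trans[OF sym, rotated])
  thus ?thesis by (rule image_eqI) simp
qed

text \<open>
  If \<open>w\<close> is the preimage of \<open>v\<close> under the block of the Hessian, then
  \<open>v \<bullet> z\<close> is the Hessian form at \<open>(w, z)\<close> and the dual norm of \<open>v\<close> is the
  local norm of \<open>w\<close>, so this is the Cauchy-Schwarz inequality of that form.
\<close>
lemma inner_le_dual_norm:
  assumes A: "pos_def (hess (fin f) x)" and v: "v \<in> block_space blk i" and z: "z \<in> block_space blk i"
  shows "\<bar>v \<bullet> z\<bar> \<le> local_dual_norm f blk i x v * local_norm f blk i x z"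
proof -
  let ?A = "hess (fin f) x"
  define w where "w = block_hess_inv f blk i x v"
  have im: "v \<in> (*v) (block_hess f blk i x) ` block_space blk i"
    unfolding block_hess_def by (rule submat_surj_on_block_space[OF A v])
  have w: "w \<in> block_space blk i" "submat blk i ?A *v w = v"
    using inv_into_into[OF im] f_inv_into_f[OF im] by (auto simp: w_def block_hess_inv_def block_hess_def)
  have "v \<bullet> u = w \<bullet> (?A *v u)" if "u \<in> block_space blk i" for u
    using inner_submat_mult_vec[OF that w(1), of ?A] w(2) pos_def_inner_commute[OF A, of u w]
    by (simp add: inner_commute)
  from this[OF z] this[OF w(1)] show ?thesis
    using pos_def_Cauchy_Schwarz[OF A, of w z] inner_submat_mult_vec[OF z z, of ?A]
    by (simp add: local_dual_norm_def local_norm_def block_hess_def w_def)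
qed

lemma matrix_quadratic_form: "u \<bullet> (A *v u) = (\<Sum>i\<in>UNIV. \<Sum>j\<in>UNIV. u $ i * (A $ i $ j * u $ j))"
  for u :: "real^'n"
  by (simp add: inner_vec_def matrix_vector_mult_def sum_distrib_left)

text \<open>
  The form is continuous and positive on the compact product of \<open>S\<close> with the unit sphere.
\<close>
lemma compact_quadratic_form_bounds:
  fixes A :: "'a::topological_space \<Rightarrow> real^'n^'n"
  assumes S: "compact S" and A: "continuous_on S A" and pd: "\<And>x. x \<in> S \<Longrightarrow> pos_def (A x)"
  obtains m M where "0 < m" "0 \<le> M"
    "\<And>x u. x \<in> S \<Longrightarrow> m * (norm u)\<^sup>2 \<le> u \<bullet> (A x *v u)"
    "\<And>x u. x \<in> S \<Longrightarrow> u \<bullet> (A x *v u) \<le> M * (norm u)\<^sup>2"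
proof (cases "S = {}")
  case True
  show ?thesis by (rule that[of 1 0]) (use True in auto)
next
  case False
  let ?K = "S \<times> sphere (0::real^'n) 1"
  \<comment> \<open>By homogeneity the extrema over the unit sphere suffice.\<close>
  define q where "q z = snd z \<bullet> (A (fst z) *v snd z)" for z :: "'a \<times> (real^'n)"
  have K: "compact ?K" by (intro compact_Times S compact_sphere)
  obtain e :: "real^'n" where "norm e = 1" using vector_choose_size[of 1] by auto
  hence ne: "?K \<noteq> {}" using False by auto
  have A': "continuous_on ?K (\<lambda>z. A (fst z))"
    by (rule continuous_on_compose2[OF A continuous_on_fst[OF continuous_on_id]]) auto
  have cont: "continuous_on ?K q"
    unfolding q_def matrix_quadratic_form by (intro continuous_intros A')
  obtain z1 where z1: "z1 \<in> ?K" "\<And>z. z \<in> ?K \<Longrightarrow> q z1 \<le> q z"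
    using continuous_attains_inf[OF K ne cont] by blast
  obtain z2 where z2: "z2 \<in> ?K" "\<And>z. z \<in> ?K \<Longrightarrow> q z \<le> q z2"
    using continuous_attains_sup[OF K ne cont] by blast
  have pos: "0 < q z" if "z \<in> ?K" for z
  proof -
    have "snd z \<noteq> 0" using that by (auto simp: mem_Times_iff)
    thus ?thesis using pd[of "fst z"] that by (simp add: q_def pos_def_def mem_Times_iff)
  qed
  have scale: "q z1 * (norm u)\<^sup>2 \<le> u \<bullet> (A x *v u) \<and> u \<bullet> (A x *v u) \<le> q z2 * (norm u)\<^sup>2"
    if x: "x \<in> S" for x u
  proof (cases "u = 0")
    case False
    define w where "w = (1 / norm u) *\<^sub>R u"
    have w: "norm w = 1" "u = norm u *\<^sub>R w" using False by (auto simp: w_def)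
    have mem: "(x, w) \<in> ?K" using x w by simp
    have "u \<bullet> (A x *v u) = q (x, w) * (norm u)\<^sup>2"
      by (subst (1 2) w(2)) (simp add: q_def matrix_vector_mult_scaleR power2_eq_square)
    thus ?thesis using z1(2)[OF mem] z2(2)[OF mem] by (auto intro!: mult_right_mono)
  qed simp
  show ?thesis
    by (rule that[of "q z1" "q z2"]) (use pos z1 z2 scale less_imp_le in blast)+
qed

section \<open>Lower semicontinuity\<close>

text \<open>
  A point \<open>(x, r)\<close> with \<open>r < h x\<close> has a neighbourhood disjoint from the closed
  epigraph.
\<close>
lemma closed_convex_on_lsc:
  assumes cc: "closed_convex_on S h" and X: "X \<longlonglongrightarrow> x" and S: "\<And>n. X n \<in> S"
  shows "h x \<le> liminf (\<lambda>n. h (X n))"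
  unfolding le_Liminf_iff
proof safe
  fix c assume "c < h x"
  then obtain r where r: "c < ereal r" "ereal r < h x" using ereal_dense2 by blast
  let ?U = "- eepigraph S h"
  have "open ?U" using cc by (simp add: closed_convex_on_def open_Compl)
  moreover have "(x, r) \<in> ?U" using r by (auto simp: eepigraph_def)
  moreover have "(\<lambda>n. (X n, r)) \<longlonglongrightarrow> (x, r)" by (intro tendsto_intros X)
  ultimately have "\<forall>\<^sub>F n in sequentially. (X n, r) \<in> ?U" by (intro topological_tendstoD)
  thus "\<forall>\<^sub>F n in sequentially. c < h (X n)"
    by eventually_elim (use S r in \<open>auto simp: eepigraph_def intro: less_trans\<close>)
qed

lemma liminf_add_lower_bound:
  fixes a b :: ereal
  assumes "a \<le> liminf u" "b \<le> liminf v" "a \<noteq> -\<infinity>" "b \<noteq> -\<infinity>"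
  shows "a + b \<le> liminf (\<lambda>n. u n + v n)"
proof -
  have "a + b \<le> liminf u + liminf v" by (rule add_mono[OF assms(1,2)])
  also have "\<dots> \<le> liminf (\<lambda>n. u n + v n)"
    by (rule ereal_liminf_add_mono) (use assms in auto)
  finally show ?thesis .
qed

lemma liminf_sum_lower_bound:
  fixes a :: "'i \<Rightarrow> ereal"
  assumes "finite I" "\<And>i. i \<in> I \<Longrightarrow> a i \<le> liminf (u i)" "\<And>i. i \<in> I \<Longrightarrow> a i \<noteq> -\<infinity>"
  shows "(\<Sum>i\<in>I. a i) \<le> liminf (\<lambda>n. \<Sum>i\<in>I. u i n) \<and> (\<Sum>i\<in>I. a i) \<noteq> -\<infinity>"
  using assms
proof (induction I rule: finite_induct)
  case empty thus ?case by (simp add: Liminf_const)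
next
  case (insert i I)
  hence "a i + sum a I \<le> liminf (\<lambda>n. u i n + (\<Sum>i\<in>I. u i n))"
    by (intro liminf_add_lower_bound) auto
  thus ?case using insert by auto
qed

text \<open>
  Lower semicontinuity at one point bounds \<open>g y\<close> from below by \<open>g x - \<epsilon>\<close> for
  \<open>y\<close> near \<open>x\<close>; continuity on the compact set makes the radius independent of
  \<open>x\<close>. The point \<open>y\<close> may lie outside \<open>S\<close>, where \<open>g\<close> can jump upwards.
\<close>
lemma compact_lsc_uniform_lower_bound:
  fixes g :: "'a::metric_space \<Rightarrow> ereal"
  assumes S: "compact S" and cont: "continuous_on S (fin g)"
    and real: "\<And>x. x \<in> S \<Longrightarrow> g x = ereal (fin g x)"
    and lsc: "\<And>X x. X \<longlonglongrightarrow> x \<Longrightarrow> g x \<le> liminf (\<lambda>n. g (X n))"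
    and e: "0 < \<epsilon>"
  obtains \<delta> where "0 < \<delta>" "\<And>x y. x \<in> S \<Longrightarrow> dist x y < \<delta> \<Longrightarrow> ereal (fin g x - \<epsilon>) < g y"
proof -
  have "\<exists>\<delta>>0. \<forall>x\<in>S. \<forall>y. dist x y < \<delta> \<longrightarrow> ereal (fin g x - \<epsilon>) < g y"
  proof (rule ccontr)
    assume neg: "\<not> ?thesis"
    have "\<exists>x y. x \<in> S \<and> dist x y < inverse (real (Suc n)) \<and> g y \<le> ereal (fin g x - \<epsilon>)" for n
    proof -
      have "0 < inverse (real (Suc n))" by simp
      thus ?thesis using neg not_less by metis
    qed
    then obtain X Y where X: "\<And>n. X n \<in> S" and XY: "\<And>n. dist (X n) (Y n) < inverse (real (Suc n))"
      and gY: "\<And>n. g (Y n) \<le> ereal (fin g (X n) - \<epsilon>)" by metis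
    obtain x r where x: "x \<in> S" and r: "strict_mono r" and lim: "(X \<circ> r) \<longlonglongrightarrow> x"
      using S X unfolding compact_def by metis
    have "(\<lambda>n. dist (X (r n)) (Y (r n))) \<longlonglongrightarrow> 0"
    proof (rule tendsto_sandwich[of "\<lambda>_. 0" _ _ "\<lambda>n. inverse (real (Suc (r n)))"])
      show "(\<lambda>n. inverse (real (Suc (r n)))) \<longlonglongrightarrow> 0"
        using LIMSEQ_subseq_LIMSEQ[OF LIMSEQ_inverse_real_of_nat r] by (simp add: o_def)
    qed (use XY less_imp_le in \<open>auto intro!: always_eventually\<close>)
    moreover have "(\<lambda>n. dist (X (r n)) x) \<longlonglongrightarrow> 0"
      using lim unfolding tendsto_dist_iff[of "X \<circ> r"] by (simp add: o_def)
    ultimately have "(\<lambda>n. dist (X (r n)) (Y (r n)) + dist (X (r n)) x) \<longlonglongrightarrow> 0 + 0"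
      by (rule tendsto_add)
    hence sum0: "(\<lambda>n. dist (X (r n)) (Y (r n)) + dist (X (r n)) x) \<longlonglongrightarrow> 0" by simp
    have "dist (Y (r n)) x \<le> dist (X (r n)) (Y (r n)) + dist (X (r n)) x" for n
      using dist_triangle[of "Y (r n)" x "X (r n)"] by (simp add: dist_commute)
    hence "(\<lambda>n. dist (Y (r n)) x) \<longlonglongrightarrow> 0"
      by (intro tendsto_sandwich[OF _ _ tendsto_const sum0]) (auto intro!: always_eventually)
    hence limY: "(\<lambda>n. Y (r n)) \<longlonglongrightarrow> x" unfolding tendsto_dist_iff[of "\<lambda>n. Y (r n)"] .
    have limg: "(\<lambda>n. fin g (X (r n))) \<longlonglongrightarrow> fin g x"
      using continuous_on_tendsto_compose[OF cont lim x] X by (simp add: o_def)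
    have "ereal (fin g x - \<epsilon> / 2) < g x" using real[OF x] e by simp
    also have "\<dots> \<le> liminf (\<lambda>n. g (Y (r n)))" by (rule lsc[OF limY])
    finally have "\<forall>\<^sub>F n in sequentially. ereal (fin g x - \<epsilon> / 2) < g (Y (r n))"
      using less_LiminfD by blast
    moreover have "\<forall>\<^sub>F n in sequentially. fin g (X (r n)) < fin g x + \<epsilon> / 2"
      using limg e by (intro order_tendstoD) auto
    ultimately have "\<forall>\<^sub>F n in sequentially. False"
    proof eventually_elim
      fix n assume a: "ereal (fin g x - \<epsilon> / 2) < g (Y (r n))" "fin g (X (r n)) < fin g x + \<epsilon> / 2"
      have "ereal (fin g x - \<epsilon> / 2) < ereal (fin g (X (r n)) - \<epsilon>)" using a(1) gY by (rule less_le_trans)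
      thus False using a(2) by simp
    qed
    thus False by simp
  qed
  thus ?thesis using that by blast
qed

section \<open>The composite problem and the decrease in one block step\<close>

text \<open>
  The right-hand side has derivative \<open>1 / (1 + l) + l\<^sup>2 / (2 (1 + l)\<^sup>2)\<close>. This is
  the calculus behind the decrease \<open>l\<^sup>2 / (4 (1 + l))\<close>.
\<close>
lemma ln_one_plus_le:
  fixes l :: real
  assumes "0 \<le> l"
  shows "ln (1 + l) \<le> (l + l\<^sup>2 / 2) / (1 + l)"
proof -
  have "(\<lambda>t. (t + t\<^sup>2 / 2) / (1 + t) - ln (1 + t)) 0 \<le> (\<lambda>t. (t + t\<^sup>2 / 2) / (1 + t) - ln (1 + t)) l"
  proof (rule DERIV_nonneg_imp_nondecreasing[OF assms])
    fix t :: real assume t: "0 \<le> t" "t \<le> l"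
    have "c / (a * a) - 1 / a = (c - a) / (a * a)" if "a \<noteq> 0" for a c :: real
      using that by (simp add: field_simps)
    from this[of "1 + t" "(1 + t) * (1 + t) - (t + t\<^sup>2 / 2)"]
    have eq: "((1 + t) * (1 + t) - (t + t\<^sup>2 / 2)) / ((1 + t) * (1 + t)) - 1 / (1 + t)
        = t\<^sup>2 / 2 / ((1 + t) * (1 + t))"
      using t by (simp add: algebra_simps power2_eq_square)
    have der: "((\<lambda>t. (t + t\<^sup>2 / 2) / (1 + t) - ln (1 + t)) has_real_derivative
        ((1 + t) * (1 + t) - (t + t\<^sup>2 / 2)) / ((1 + t) * (1 + t)) - 1 / (1 + t)) (at t)"
      using t by (auto intro!: derivative_eq_intros)
    show "\<exists>y. ((\<lambda>t. (t + t\<^sup>2 / 2) / (1 + t) - ln (1 + t)) has_real_derivative y) (at t) \<and> 0 \<le> y"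
      using der unfolding eq by (intro exI conjI) (assumption, simp)
  qed
  thus ?thesis by simp
qed

lemma decrement_mono:
  fixes a b :: real
  assumes "0 \<le> a" "a \<le> b"
  shows "a\<^sup>2 / (4 * (1 + a)) \<le> b\<^sup>2 / (4 * (1 + b))"
proof -
  have "a * (a * b) \<le> b * (a * b)" using assms by (intro mult_right_mono) auto
  moreover have "a * a \<le> b * b" using assms by (intro mult_mono) auto
  ultimately have "a\<^sup>2 * (4 * (1 + b)) \<le> b\<^sup>2 * (4 * (1 + a))"
    by (simp add: power2_eq_square algebra_simps)
  thus ?thesis using assms by (simp add: frac_le_eq divide_simps)
qed

locale rbpdn_problem =
  fixes f :: "real^'n \<Rightarrow> ereal"
    and blk :: "'n \<Rightarrow> 'b::finite"
    and gs :: "'b \<Rightarrow> real^'n \<Rightarrow> ereal"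
    and d :: "'b \<Rightarrow> real^'n \<Rightarrow> real^'n"
    and x0 :: "real^'n"
    and \<eta> :: real
    and F :: "real^'n \<Rightarrow> ereal"
  defines "F \<equiv> objective f blk gs"
  assumes gs_proper: "\<And>i. proper_on (block_space blk i) (gs i)"
    and gs_closed_convex: "\<And>i. closed_convex_on (block_space blk i) (gs i)"
    and f_sc: "standard_self_concordant f"
    and hess_cont: "continuous_on (edom UNIV F) (hess (fin f))"
    and hess_pos_def: "\<And>x. x \<in> edom UNIV F \<Longrightarrow> pos_def (hess (fin f) x)"
    and unique_min: "\<exists>!x. is_arg_min F (\<lambda>_. True) x"
    and x0_dom: "x0 \<in> edom UNIV F"
    and eta: "0 \<le> \<eta>" "\<eta> \<le> 1/4"
    and approx: "\<And>x i. x \<in> edom UNIV F \<Longrightarrow> approx_direction f blk gs \<eta> i x (d i x)"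
    and g_lipschitz: "\<exists>L. L-lipschitz_on {x. F x \<le> F x0} (fin (block_sep blk gs))"
begin

abbreviation "B i \<equiv> block_space blk i"
abbreviation "sub i \<equiv> subvec blk i"
abbreviation "H x \<equiv> hess (fin f) x"
abbreviation "G x \<equiv> block_sep blk gs x"

text \<open>The quantity \<open>\<lambda>\<^sub>i(x)\<close> that damps the step in block \<open>i\<close>.\<close>
definition lam :: "'b \<Rightarrow> real^'n \<Rightarrow> real" where
  "lam i x = local_norm f blk i x (d i x)"

lemma f_not_MInf: "f x \<noteq> -\<infinity>"
  using f_sc by (simp add: standard_self_concordant_def)

lemma gs_not_MInf: "y \<in> B i \<Longrightarrow> gs i y \<noteq> -\<infinity>"
  using gs_proper[of i] by (simp add: proper_on_def)

lemma G_not_MInf: "G x \<noteq> -\<infinity>"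
proof -
  have "(\<Sum>i\<in>I. gs i (sub i x)) \<noteq> -\<infinity>" if "finite I" for I
    using that by induction (auto simp: gs_not_MInf)
  thus ?thesis by (simp add: block_sep_def)
qed

lemma dom_G_iff: "G x < \<infinity> \<longleftrightarrow> (\<forall>i. sub i x \<in> edom (B i) (gs i))"
  using sum_Pinfty[of "\<lambda>i. gs i (sub i x)" UNIV] by (auto simp: block_sep_def edom_def)

lemma dom_F_iff: "x \<in> edom UNIV F \<longleftrightarrow> x \<in> edom UNIV f \<and> (\<forall>i. sub i x \<in> edom (B i) (gs i))"
  unfolding dom_G_iff[symmetric] by (auto simp: F_def objective_def edom_def)

lemma f_real: "x \<in> edom UNIV f \<Longrightarrow> f x = ereal (fin f x)"
  by (rule edom_imp_ereal_fin) (auto simp: f_not_MInf)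

lemma gs_real: "y \<in> edom (B i) (gs i) \<Longrightarrow> gs i y = ereal (fin (gs i) y)"
  by (rule edom_imp_ereal_fin) (auto simp: gs_not_MInf)

lemma G_real:
  assumes "\<And>i. sub i x \<in> edom (B i) (gs i)"
  shows "G x = ereal (\<Sum>i\<in>UNIV. fin (gs i) (sub i x))"
  using gs_real[OF assms] by (simp add: block_sep_def)

lemma F_real:
  assumes "x \<in> edom UNIV F"
  shows "F x = ereal (fin F x)"
    and "fin F x = fin f x + fin G x" "fin G x = (\<Sum>i\<in>UNIV. fin (gs i) (sub i x))"
    and "G x = ereal (fin G x)"
proof -
  have G: "G x = ereal (\<Sum>i\<in>UNIV. fin (gs i) (sub i x))" using assms by (intro G_real) (simp add: dom_F_iff)
  have f: "f x = ereal (fin f x)" using assms by (intro f_real) (simp add: dom_F_iff)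
  show g: "fin G x = (\<Sum>i\<in>UNIV. fin (gs i) (sub i x))" using G by (simp add: fin_def)
  show "G x = ereal (fin G x)" using G g by simp
  have "F x = ereal (fin f x + fin G x)" unfolding F_def objective_def f G g by simp
  thus "fin F x = fin f x + fin G x" "F x = ereal (fin F x)" by (auto simp: fin_def)
qed

lemma local_norm_eq:
  assumes "y \<in> B i" shows "local_norm f blk i x y = sqrt (y \<bullet> (H x *v y))"
  by (simp add: local_norm_def block_hess_def inner_submat_mult_vec assms)

lemma local_norm_nonneg:
  assumes "x \<in> edom UNIV F" "y \<in> B i" shows "0 \<le> local_norm f blk i x y"
  by (simp add: local_norm_eq assms pos_def_nonneg[OF hess_pos_def])

lemma lam_nonneg: "x \<in> edom UNIV F \<Longrightarrow> 0 \<le> lam i x"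
  using approx[of x i] by (auto simp: lam_def approx_direction_def intro: local_norm_nonneg)

lemma direction_in_block: "x \<in> edom UNIV F \<Longrightarrow> d i x \<in> B i"
  using approx[of x i] by (simp add: approx_direction_def)

text \<open>
  The inexact optimality condition in real-valued form. The subgradient inequality at a point of
  the domain of \<open>gs i\<close> shows that the undamped trial point is in that domain, so all values
  involved are finite.
\<close>
lemma subgradient_at_trial_point:
  assumes x: "x \<in> edom UNIV F"
  obtains s v where "s \<in> B i" "v \<in> B i"
    "s = - v - block_grad f blk i x - submat blk i (H x) *v d i x"
    "sub i x + d i x \<in> edom (B i) (gs i)"
    "\<And>z. z \<in> edom (B i) (gs i) \<Longrightarrow> fin (gs i) (sub i x + d i x) + s \<bullet> (z - (sub i x + d i x)) \<le> fin (gs i) z"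
    "\<And>z. z \<in> B i \<Longrightarrow> \<bar>v \<bullet> z\<bar> \<le> \<eta> * lam i x * local_norm f blk i x z"
proof -
  obtain v s where v: "v \<in> B i" "local_dual_norm f blk i x v \<le> \<eta> * lam i x"
    and s: "s \<in> subdiff_on (B i) (gs i) (sub i x + d i x)"
    and vs: "- v = block_grad f blk i x + block_hess f blk i x *v d i x + s"
    using approx[OF x, of i] by (auto simp: approx_direction_def lam_def)
  define y where "y = sub i x + d i x"
  have yB: "y \<in> B i" unfolding y_def
    using direction_in_block[OF x] by (intro subspace_add[OF subspace_block_space]) auto
  have s_le: "gs i y + ereal (s \<bullet> (z - y)) \<le> gs i z" if "z \<in> B i" for z
    using s that by (simp add: subdiff_on_def y_def)
  obtain z0 where z0: "z0 \<in> B i" "gs i z0 < \<infinity>" using gs_proper[of i] by (auto simp: proper_on_def edom_def)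
  have y: "y \<in> edom (B i) (gs i)" using s_le[OF z0(1)] z0 yB by (auto simp: edom_def)
  show thesis
  proof (rule that[of s v])
    show "s = - v - block_grad f blk i x - submat blk i (H x) *v d i x"
      using vs by (simp add: block_hess_def algebra_simps)
    show "fin (gs i) (sub i x + d i x) + s \<bullet> (z - (sub i x + d i x)) \<le> fin (gs i) z"
      if "z \<in> edom (B i) (gs i)" for z
      using s_le[of z] gs_real[OF y] gs_real[OF that] that by (simp add: y_def edom_def)
    show "\<bar>v \<bullet> z\<bar> \<le> \<eta> * lam i x * local_norm f blk i x z" if "z \<in> B i" for z
      using inner_le_dual_norm[OF hess_pos_def[OF x] v(1) that] v(2) local_norm_nonneg[OF x that]
      by (meson mult_right_mono order_trans)
    show "s \<in> B i" using s by (simp add: subdiff_on_def)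
  qed (use v y y_def in auto)
qed

lemma rbpdn_step_eq:
  assumes "x \<in> edom UNIV F"
  shows "rbpdn_step f blk d i x = x + (1 / (1 + lam i x)) *\<^sub>R d i x"
  using direction_in_block[OF assms, of i] by (auto simp: rbpdn_step_def lam_def block_space_def vec_eq_iff)

lemma sub_step:
  assumes "y \<in> B i"
  shows "sub j (x + y) = (if j = i then sub i x + y else sub j x)"
  using assms by (auto simp: linear_add[OF linear_subvec] subvec_eq_self subvec_other_block)

text \<open>
  With \<open>\<tau> = 1 / (1 + l)\<close>, the smooth part changes by at most
  \<open>\<tau> (\<nabla>f \<bullet> D) - l \<tau> + ln (1 + l)\<close>, and the block of \<open>g\<close> by at most
  \<open>\<tau> (s \<bullet> D)\<close> because the new point lies on the segment from \<open>x\<^sub>i\<close> to the trial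
  point. The inexact optimality condition makes \<open>s \<bullet> D\<close> at most
  \<open>\<eta> l\<^sup>2 - \<nabla>f \<bullet> D - l\<^sup>2\<close>, so the gradient terms cancel.
\<close>
lemma step_decrease:
  assumes x: "x \<in> edom UNIV F"
  shows "rbpdn_step f blk d i x \<in> edom UNIV F"
    and "fin F (rbpdn_step f blk d i x) \<le> fin F x - (lam i x)\<^sup>2 / (4 * (1 + lam i x))"
proof -
  define l where "l = lam i x"
  define \<tau> where "\<tau> = 1 / (1 + l)"
  define D where "D = d i x"
  define y where "y = sub i x + D"
  define x' where "x' = x + \<tau> *\<^sub>R D"
  have x'_eq: "rbpdn_step f blk d i x = x'" by (simp add: rbpdn_step_eq[OF x] x'_def \<tau>_def l_def D_def)
  have l0: "0 \<le> l" by (simp add: l_def lam_nonneg[OF x])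
  have \<tau>: "0 < \<tau>" "\<tau> \<le> 1" "l * \<tau> = 1 - \<tau>" using l0 by (auto simp: \<tau>_def field_simps)
  have DB: "D \<in> B i" by (simp add: D_def direction_in_block[OF x])
  have xf: "x \<in> edom UNIV f" and xg: "\<And>j. sub j x \<in> edom (B j) (gs j)" using x by (auto simp: dom_F_iff)
  have l_eq: "l = sqrt (D \<bullet> (H x *v D))" by (simp add: l_def lam_def local_norm_eq DB[unfolded D_def] D_def)
  have lsq: "D \<bullet> (H x *v D) = l\<^sup>2" using pos_def_nonneg[OF hess_pos_def[OF x]] by (simp add: l_eq)
  obtain s v where s: "s \<in> B i" "v \<in> B i"
    "s = - v - block_grad f blk i x - submat blk i (H x) *v D"
    "y \<in> edom (B i) (gs i)"
    "\<And>z. z \<in> edom (B i) (gs i) \<Longrightarrow> fin (gs i) y + s \<bullet> (z - y) \<le> fin (gs i) z"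
    "\<And>z. z \<in> B i \<Longrightarrow> \<bar>v \<bullet> z\<bar> \<le> \<eta> * l * local_norm f blk i x z"
    using subgradient_at_trial_point[OF x, of i] unfolding D_def y_def l_def by metis
  have "s \<bullet> D = - (v \<bullet> D) - grad (fin f) x \<bullet> D - l\<^sup>2"
    using inner_subvec[OF DB, of "grad (fin f) x"] inner_submat_mult_vec[OF DB DB, of "H x"] lsq
    by (simp add: s(3) inner_diff_left inner_diff_right block_grad_def inner_commute)
  moreover have "\<bar>v \<bullet> D\<bar> \<le> \<eta> * l * l"
    using s(6)[OF DB] by (simp add: l_def lam_def D_def)
  ultimately have sD: "s \<bullet> D \<le> \<eta> * l\<^sup>2 - grad (fin f) x \<bullet> D - l\<^sup>2" by (simp add: power2_eq_square)
  have gy: "fin (gs i) y \<le> fin (gs i) (sub i x) + s \<bullet> D"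
    using s(5)[OF xg[of i]] by (simp add: y_def inner_diff_right)
  have lt: "l * \<tau> < 1" "0 \<le> \<tau>" using \<tau> by auto
  have ln\<tau>: "ln (1 - l * \<tau>) = - ln (1 + l)" using \<tau>(3) l0 by (simp add: \<tau>_def ln_div)
  have f': "x' \<in> edom UNIV f" "fin f x' \<le> fin f x + (grad (fin f) x \<bullet> D) * \<tau> - l * \<tau> + ln (1 + l)"
    using self_concordant_upper_bound[OF f_sc xf l_eq lt(2,1)] ln\<tau> by (auto simp: x'_def)
  have conv: "convex_on (edom (B i) (gs i)) (fin (gs i))"
    by (intro convex_on_fin gs_closed_convex gs_not_MInf)
  have sub': "sub j x' = (if j = i then (1 - \<tau>) *\<^sub>R sub i x + \<tau> *\<^sub>R y else sub j x)" for j
    using sub_step[of "\<tau> *\<^sub>R D" i j x] DB subspace_scale[OF subspace_block_space DB]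
    by (simp add: x'_def y_def algebra_simps)
  have g'dom: "sub i x' \<in> edom (B i) (gs i)"
    using conv xg[of i] s(4) \<tau> unfolding convex_on_def convex_def sub' by auto
  have g'i: "fin (gs i) (sub i x') \<le> (1 - \<tau>) * fin (gs i) (sub i x) + \<tau> * fin (gs i) y"
    using conv xg[of i] s(4) \<tau> unfolding convex_on_def sub' by auto
  have "\<tau> * fin (gs i) y \<le> \<tau> * (fin (gs i) (sub i x) + s \<bullet> D)"
    using gy \<tau> by (intro mult_left_mono) auto
  hence g'i: "fin (gs i) (sub i x') \<le> fin (gs i) (sub i x) + \<tau> * (s \<bullet> D)"
    using g'i by (simp add: algebra_simps)
  have "sub j x' \<in> edom (B j) (gs j)" for j using g'dom xg[of j] sub'[of j] by (cases "j = i") auto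
  hence x'F: "x' \<in> edom UNIV F" using f' by (simp add: dom_F_iff)
  thus "rbpdn_step f blk d i x \<in> edom UNIV F" by (simp add: x'_eq)
  have "(\<Sum>j\<in>UNIV - {i}. fin (gs j) (sub j x')) = (\<Sum>j\<in>UNIV - {i}. fin (gs j) (sub j x))"
    by (rule sum.cong) (auto simp: sub')
  hence "fin G x' - fin G x = fin (gs i) (sub i x') - fin (gs i) (sub i x)"
    by (simp add: F_real(3)[OF x'F] F_real(3)[OF x] sum.remove[of UNIV i])
  hence "fin F x' - fin F x \<le> (grad (fin f) x \<bullet> D) * \<tau> - l * \<tau> + ln (1 + l) + \<tau> * (s \<bullet> D)"
    using f'(2) g'i by (simp add: F_real(2)[OF x'F] F_real(2)[OF x])
  also have "\<dots> \<le> (grad (fin f) x \<bullet> D) * \<tau> - l * \<tau> + ln (1 + l) + \<tau> * (\<eta> * l\<^sup>2 - grad (fin f) x \<bullet> D - l\<^sup>2)"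
    using sD \<tau> by (intro add_left_mono mult_left_mono) auto
  also have "\<dots> = - l * \<tau> + ln (1 + l) + \<tau> * (\<eta> * l\<^sup>2 - l\<^sup>2)" by (simp add: algebra_simps)
  also have "\<dots> \<le> - l * \<tau> + (l + l\<^sup>2 / 2) * \<tau> + \<tau> * (l\<^sup>2 / 4 - l\<^sup>2)"
  proof (intro add_mono order.refl)
    show "ln (1 + l) \<le> (l + l\<^sup>2 / 2) * \<tau>" using ln_one_plus_le[OF l0] by (simp add: \<tau>_def)
    show "\<tau> * (\<eta> * l\<^sup>2 - l\<^sup>2) \<le> \<tau> * (l\<^sup>2 / 4 - l\<^sup>2)"
      using mult_right_mono[OF eta(2), of "l\<^sup>2"] \<tau> by (intro mult_left_mono) auto
  qed
  also have "\<dots> = - (l\<^sup>2 / 4 * \<tau>)" by (simp add: algebra_simps)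
  also have "\<dots> = - (l\<^sup>2 / (4 * (1 + l)))" by (simp add: \<tau>_def)
  finally show "fin F (rbpdn_step f blk d i x) \<le> fin F x - (lam i x)\<^sup>2 / (4 * (1 + lam i x))"
    by (simp add: x'_eq l_def)
qed

end

section \<open>The initial sublevel set\<close>

context rbpdn_problem
begin

definition xstar :: "real^'n" where "xstar = (THE x. is_arg_min F (\<lambda>_. True) x)"

definition S :: "(real^'n) set" where "S = {x. F x \<le> F x0}"

lemma F_xstar_le: "F xstar \<le> F x"
proof -
  have "is_arg_min F (\<lambda>_. True) xstar" using theI'[OF unique_min] unfolding xstar_def .
  thus ?thesis by (auto simp: is_arg_min_def not_less)
qed

lemma F_le_xstar_imp_eq:
  assumes "F x \<le> F xstar" shows "x = xstar"
proof -
  have "is_arg_min F (\<lambda>_. True) x"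
    using assms F_xstar_le unfolding is_arg_min_def by (meson not_less order_trans)
  moreover have "is_arg_min F (\<lambda>_. True) xstar" using theI'[OF unique_min] unfolding xstar_def .
  ultimately show ?thesis using unique_min by blast
qed

lemma S_dom: "x \<in> S \<Longrightarrow> x \<in> edom UNIV F"
  using x0_dom by (auto simp: S_def edom_def)

lemma x0_S: "x0 \<in> S" and xstar_S: "xstar \<in> S"
  by (simp_all add: S_def F_xstar_le)

lemma S_iff: "x \<in> S \<longleftrightarrow> x \<in> edom UNIV F \<and> fin F x \<le> fin F x0"
proof -
  have "F x \<le> F x0 \<longleftrightarrow> fin F x \<le> fin F x0" if "x \<in> edom UNIV F"
    by (subst F_real(1)[OF that], subst F_real(1)[OF x0_dom]) simp
  thus ?thesis using S_dom[of x] unfolding S_def by blast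
qed

lemma fin_F_xstar_le:
  assumes "x \<in> edom UNIV F" shows "fin F xstar \<le> fin F x"
proof -
  have "ereal (fin F xstar) \<le> ereal (fin F x)"
    unfolding F_real(1)[OF assms, symmetric] F_real(1)[OF S_dom[OF xstar_S], symmetric] by (rule F_xstar_le)
  thus ?thesis by simp
qed

lemma G_lsc:
  assumes X: "X \<longlonglongrightarrow> x" shows "G x \<le> liminf (\<lambda>n. G (X n))"
proof -
  have "gs i (sub i x) \<le> liminf (\<lambda>n. gs i (sub i (X n)))" for i
  proof (rule closed_convex_on_lsc[OF gs_closed_convex])
    have "bounded_linear (sub i)" using linear_subvec[of blk i] by (simp add: linear_conv_bounded_linear)
    thus "(\<lambda>n. sub i (X n)) \<longlonglongrightarrow> sub i x" using X by (rule bounded_linear.tendsto)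
  qed simp
  thus ?thesis unfolding block_sep_def
    using liminf_sum_lower_bound[of UNIV "\<lambda>i. gs i (sub i x)" "\<lambda>i n. gs i (sub i (X n))"]
    by (simp add: gs_not_MInf)
qed

text \<open>
  The sum of lower semicontinuous functions is lower semicontinuous as neither takes the value
  \<open>-\<infinity>\<close>.
\<close>
lemma F_lsc:
  assumes X: "X \<longlonglongrightarrow> x" shows "F x \<le> liminf (\<lambda>n. F (X n))"
  unfolding F_def objective_def
proof (rule liminf_add_lower_bound)
  have "closed_convex_on UNIV f" using f_sc by (simp add: standard_self_concordant_def)
  from closed_convex_on_lsc[OF this X] show "f x \<le> liminf (\<lambda>n. f (X n))" by simp
qed (auto simp: G_lsc[OF X] f_not_MInf G_not_MInf)

lemma convex_on_F: "convex_on (edom UNIV F) (fin F)"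
proof -
  have key: "u *\<^sub>R x + v *\<^sub>R y \<in> edom UNIV F \<and> fin F (u *\<^sub>R x + v *\<^sub>R y) \<le> u * fin F x + v * fin F y"
    if x: "x \<in> edom UNIV F" and y: "y \<in> edom UNIV F" and uv: "0 \<le> u" "0 \<le> v" "u + v = 1" for x y u v
  proof -
    let ?w = "u *\<^sub>R x + v *\<^sub>R y"
    have f: "?w \<in> edom UNIV f \<and> fin f ?w \<le> u * fin f x + v * fin f y"
      using self_concordant_convex_on[OF f_sc] x y uv
      unfolding convex_on_def convex_def dom_F_iff by blast
    have sub_w: "sub i ?w = u *\<^sub>R sub i x + v *\<^sub>R sub i y" for i
      using linear_subvec[of blk i] by (simp add: linear_add linear_cmul)
    have g: "sub i ?w \<in> edom (B i) (gs i) \<and>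
        fin (gs i) (sub i ?w) \<le> u * fin (gs i) (sub i x) + v * fin (gs i) (sub i y)" for i
    proof -
      have "convex_on (edom (B i) (gs i)) (fin (gs i))"
        by (intro convex_on_fin gs_closed_convex gs_not_MInf)
      thus ?thesis using x y uv unfolding sub_w convex_on_def convex_def dom_F_iff by blast
    qed
    have w: "?w \<in> edom UNIV F" using f g by (simp add: dom_F_iff)
    have "fin G ?w \<le> (\<Sum>i\<in>UNIV. u * fin (gs i) (sub i x) + v * fin (gs i) (sub i y))"
      unfolding F_real(3)[OF w] by (rule sum_mono) (use g in blast)
    also have "\<dots> = u * fin G x + v * fin G y"
      by (simp add: F_real(3)[OF x] F_real(3)[OF y] sum.distrib sum_distrib_left)
    finally show ?thesis using f w
      by (simp add: F_real(2)[OF w] F_real(2)[OF x] F_real(2)[OF y] algebra_simps)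
  qed
  thus ?thesis unfolding convex_on_def convex_def by blast
qed

lemma closed_S: "closed S"
  unfolding closed_sequential_limits
proof safe
  fix X x assume X: "\<forall>n. X n \<in> S" "X \<longlonglongrightarrow> x"
  have "F x \<le> liminf (\<lambda>n. F (X n))" by (rule F_lsc[OF X(2)])
  also have "\<dots> \<le> liminf (\<lambda>n. F x0)"
    using X(1) by (intro Liminf_mono always_eventually) (auto simp: S_def)
  finally show "x \<in> S" by (simp add: S_def Liminf_const)
qed

text \<open>
  If points of the sublevel set run off to infinity, then on the segments joining them to the
  minimizer the points at distance one have, by convexity, values tending to the minimum. A
  limit of such points on the unit sphere would be a second minimizer.
\<close>
lemma bounded_S: "bounded S"
proof (rule ccontr)
  assume "\<not> bounded S"
  have "\<exists>x\<in>S. real (Suc n) < norm (x - xstar)" for n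
  proof (rule ccontr)
    assume "\<not> ?thesis"
    hence "\<forall>x\<in>S. dist xstar x \<le> real (Suc n)" by (auto simp: dist_norm norm_minus_commute not_less)
    thus False using \<open>\<not> bounded S\<close> unfolding bounded_def by blast
  qed
  then obtain X where X: "\<And>n. X n \<in> S" and far: "\<And>n. real (Suc n) < norm (X n - xstar)" by metis
  \<comment> \<open>The weight that puts the point of the segment at distance one from the minimizer.\<close>
  define t where "t n = 1 / norm (X n - xstar)" for n
  define Z where "Z n = (1 - t n) *\<^sub>R xstar + t n *\<^sub>R X n" for n
  define C where "C = fin F x0 - fin F xstar"
  have C: "0 \<le> C" using fin_F_xstar_le[OF x0_dom] by (simp add: C_def)
  have t: "0 < t n" "t n \<le> inverse (real (Suc n))" "t n \<le> 1" for n
  proof -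
    have p: "0 < real (Suc n)" by simp
    have "0 < norm (X n - xstar)" using far[of n] p by linarith
    thus "0 < t n" unfolding t_def by (rule divide_pos_pos[OF zero_less_one])
    show le: "t n \<le> inverse (real (Suc n))"
      using le_imp_inverse_le[OF less_imp_le[OF far[of n]] p] by (simp add: t_def inverse_eq_divide)
    have "inverse (real (Suc n)) \<le> 1" using inverse_le_1_iff[of "real (Suc n)"] by simp
    with le show "t n \<le> 1" by simp
  qed
  have Z_dist: "norm (Z n - xstar) = 1" for n
  proof -
    have "Z n - xstar = t n *\<^sub>R (X n - xstar)" by (simp add: Z_def algebra_simps)
    moreover have "norm (X n - xstar) \<noteq> 0" using t(1)[of n] by (auto simp: t_def)
    ultimately show ?thesis by (simp add: t_def)
  qed
  have FZ: "F (Z n) \<le> ereal (fin F xstar + inverse (real (Suc n)) * C)" for n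
  proof -
    have dom: "Z n \<in> edom UNIV F" and "fin F (Z n) \<le> (1 - t n) * fin F xstar + t n * fin F (X n)"
      using convex_on_F S_dom[OF xstar_S] S_dom[OF X[of n]] t[of n]
      unfolding convex_on_def convex_def Z_def by auto
    moreover have "t n * fin F (X n) \<le> t n * fin F x0"
      using X[of n] t(1)[of n] by (intro mult_left_mono) (auto simp: S_iff)
    ultimately have "fin F (Z n) \<le> fin F xstar + t n * C" by (simp add: C_def algebra_simps)
    also have "\<dots> \<le> fin F xstar + inverse (real (Suc n)) * C"
      using t(2)[of n] C by (intro add_left_mono mult_right_mono)
    finally show ?thesis using F_real(1)[OF dom] by simp
  qed
  have "compact (sphere xstar 1)" by simp
  moreover have "Z n \<in> sphere xstar 1" for n using Z_dist[of n] by (simp add: dist_norm norm_minus_commute)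
  ultimately obtain z r where z: "z \<in> sphere xstar 1" and r: "strict_mono r" and lim: "(Z \<circ> r) \<longlonglongrightarrow> z"
    unfolding compact_def by metis
  have "(\<lambda>n. fin F xstar + inverse (real (Suc (r n))) * C) \<longlonglongrightarrow> fin F xstar + 0 * C"
    using LIMSEQ_subseq_LIMSEQ[OF LIMSEQ_inverse_real_of_nat r] by (intro tendsto_intros) (simp add: o_def)
  hence lim2: "(\<lambda>n. ereal (fin F xstar + inverse (real (Suc (r n))) * C)) \<longlonglongrightarrow> ereal (fin F xstar)" by simp
  have "F z \<le> liminf (\<lambda>n. F (Z (r n)))" using F_lsc[OF lim] by (simp add: o_def)
  also have "\<dots> \<le> liminf (\<lambda>n. ereal (fin F xstar + inverse (real (Suc (r n))) * C))"
    by (intro Liminf_mono always_eventually allI FZ)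
  also have "\<dots> = ereal (fin F xstar)" using lim2 by (intro lim_imp_Liminf) auto
  also have "\<dots> = F xstar" using F_real(1)[OF S_dom[OF xstar_S]] by simp
  finally have "z = xstar" by (rule F_le_xstar_imp_eq)
  thus False using z by simp
qed

lemma compact_S: "compact S"
  using bounded_S closed_S by (simp add: compact_eq_bounded_closed)

lemma continuous_on_fin_G: "continuous_on S (fin G)"
proof -
  obtain L where "L-lipschitz_on S (fin (block_sep blk gs))" using g_lipschitz unfolding S_def by blast
  hence "continuous_on S (fin (block_sep blk gs))" by (rule lipschitz_on_continuous_on)
  thus ?thesis .
qed

end

section \<open>Bounding the optimality gap by the expected decrease\<close>

context rbpdn_problem
begin

lemma S_dom_f: "S \<subseteq> edom UNIV f"
  using S_dom dom_F_iff by blast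

lemma step_in_S: "x \<in> S \<Longrightarrow> rbpdn_step f blk d i x \<in> S"
proof -
  assume x: "x \<in> S"
  hence xd: "x \<in> edom UNIV F" by (rule S_dom)
  have "0 \<le> (lam i x)\<^sup>2 / (4 * (1 + lam i x))" using lam_nonneg[OF xd, of i] by simp
  thus ?thesis using step_decrease[OF xd, of i] x by (simp add: S_iff)
qed

text \<open>
  The subgradient inequality towards \<open>y\<close>, with the subgradient eliminated: its
  error term and its Hessian term are both estimated by Cauchy-Schwarz in the local norm. In this
  form the inequalities of all blocks can be added.
\<close>
lemma block_optimality_inequality:
  fixes i :: 'b and x y :: "real^'n"
  assumes x: "x \<in> edom UNIV F" and y: "y \<in> edom UNIV F"
  defines "z \<equiv> sub i (y - x) - d i x"
  shows "sub i x + d i x \<in> edom (B i) (gs i)"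
    and "fin (gs i) (sub i x + d i x)
      \<le> fin (gs i) (sub i y) + grad (fin f) x \<bullet> z + (\<eta> + 1) * lam i x * local_norm f blk i x z"
proof -
  obtain s v where s: "s \<in> B i" "v \<in> B i"
    "s = - v - block_grad f blk i x - submat blk i (H x) *v d i x"
    "sub i x + d i x \<in> edom (B i) (gs i)"
    "\<And>z. z \<in> edom (B i) (gs i) \<Longrightarrow> fin (gs i) (sub i x + d i x) + s \<bullet> (z - (sub i x + d i x)) \<le> fin (gs i) z"
    "\<And>z. z \<in> B i \<Longrightarrow> \<bar>v \<bullet> z\<bar> \<le> \<eta> * lam i x * local_norm f blk i x z"
    using subgradient_at_trial_point[OF x, of i] by metis
  show "sub i x + d i x \<in> edom (B i) (gs i)" by (rule s(4))
  have z_eq: "z = sub i y - (sub i x + d i x)"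
    using linear_subvec[of blk i] by (simp add: z_def linear_diff)
  have zB: "z \<in> B i" unfolding z_def
    by (intro subspace_diff[OF subspace_block_space] direction_in_block[OF x]) simp
  have "- (s \<bullet> z) = v \<bullet> z + grad (fin f) x \<bullet> z + z \<bullet> (H x *v d i x)"
    using inner_subvec[OF zB, of "grad (fin f) x"]
      inner_submat_mult_vec[OF zB direction_in_block[OF x, of i], of "H x"]
    by (simp add: s(3) block_grad_def inner_diff_left inner_diff_right inner_commute)
  also have "\<dots> \<le> \<eta> * lam i x * local_norm f blk i x z + grad (fin f) x \<bullet> z
      + local_norm f blk i x z * lam i x"
    using s(6)[OF zB] pos_def_Cauchy_Schwarz[OF hess_pos_def[OF x], of z "d i x"]
    by (simp add: lam_def local_norm_eq[OF zB] local_norm_eq[OF direction_in_block[OF x]])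
  finally show "fin (gs i) (sub i x + d i x)
      \<le> fin (gs i) (sub i y) + grad (fin f) x \<bullet> z + (\<eta> + 1) * lam i x * local_norm f blk i x z"
    using s(5)[of "sub i y"] y unfolding z_eq[symmetric] by (simp add: dom_F_iff algebra_simps)
qed

text \<open>
  All blocks take their undamped steps at once; this is the point whose optimality conditions
  compare \<open>x\<close> with the minimizer.
\<close>
definition trial :: "real^'n \<Rightarrow> real^'n" where
  "trial x = x + (\<Sum>i\<in>UNIV. d i x)"

lemma sub_trial:
  assumes "x \<in> edom UNIV F" shows "sub i (trial x) = sub i x + d i x"
proof -
  have "(\<Sum>j\<in>UNIV. sub i (d j x)) = (\<Sum>j\<in>UNIV. if j = i then d i x else 0)"
    by (rule sum.cong) (auto simp: subvec_eq_self direction_in_block[OF assms]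
        intro!: subvec_other_block[OF direction_in_block[OF assms]])
  thus ?thesis using linear_subvec[of blk i] by (simp add: trial_def linear_add linear_sum)
qed

text \<open>
  The optimality inequalities of all blocks with \<open>y = x*\<close> are added to the gradient inequality
  \<open>f(x) + \<nabla>f(x) \<bullet> (x* - x) \<le> f(x*)\<close>. The terms \<open>\<nabla>f(x) \<bullet> (x* - x)\<close> cancel and
  apart from \<open>g(x) - g(x + d(x))\<close> every remaining term is at most a multiple of some
  \<open>\<lambda>\<^sub>i(x)\<close>, the factor being controlled by the diameter of the sublevel set and by bounds
  for gradient and Hessian on it.
\<close>
lemma gap_le_of_small_directions:
  obtains C where "0 \<le> C"
    "\<And>x. x \<in> S \<Longrightarrow> dist x (trial x) \<le> C * (\<Sum>i\<in>UNIV. lam i x)"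
    "\<And>x. x \<in> S \<Longrightarrow> G (trial x) = ereal (fin G (trial x))"
    "\<And>x. x \<in> S \<Longrightarrow> (\<And>i. lam i x \<le> 1) \<Longrightarrow>
       fin F x - fin F xstar \<le> fin G x - fin G (trial x) + C * (\<Sum>i\<in>UNIV. lam i x)"
proof -
  have contH: "continuous_on S H" by (rule continuous_on_subset[OF hess_cont]) (use S_dom in blast)
  obtain m M where m: "0 < m" and M: "0 \<le> M"
    and Hm: "\<And>x u. x \<in> S \<Longrightarrow> m * (norm u)\<^sup>2 \<le> u \<bullet> (H x *v u)"
    and HM: "\<And>x u. x \<in> S \<Longrightarrow> u \<bullet> (H x *v u) \<le> M * (norm u)\<^sup>2"
    using compact_quadratic_form_bounds[OF compact_S contH hess_pos_def[OF S_dom]] by blast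
  have "continuous_on S (grad (fin f))"
    by (rule continuous_on_subset[OF continuous_on_grad_self_concordant[OF f_sc] S_dom_f])
  hence "bounded (grad (fin f) ` S)"
    using compact_S compact_continuous_image compact_imp_bounded by blast
  then obtain Q where Q: "0 < Q" "\<And>x. x \<in> S \<Longrightarrow> norm (grad (fin f) x) \<le> Q"
    unfolding bounded_pos by blast
  obtain R where R: "\<And>x. x \<in> S \<Longrightarrow> dist xstar x \<le> R"
    using bounded_S unfolding bounded_any_center[where a = xstar] by blast
  define C1 where "C1 = (\<eta> + 1) * sqrt M * (R + 1 / sqrt m)"
  define C where "C = 1 / sqrt m + Q / sqrt m + C1"
  have sm: "0 < sqrt m" using m by simp
  have R0: "0 \<le> R" using R[OF xstar_S] by simp
  have C1: "0 \<le> C1" unfolding C1_def using eta M R0 sm by simp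
  have d_le: "norm (d i x) \<le> lam i x / sqrt m" if x: "x \<in> S" for x i
  proof -
    have "sqrt (m * (norm (d i x))\<^sup>2) \<le> lam i x"
      unfolding lam_def local_norm_eq[OF direction_in_block[OF S_dom[OF x]]]
      by (rule real_sqrt_le_mono[OF Hm[OF x]])
    thus ?thesis using sm by (simp add: real_sqrt_mult field_simps)
  qed
  have sum_d: "norm (\<Sum>i\<in>UNIV. d i x) \<le> (\<Sum>i\<in>UNIV. lam i x) / sqrt m" if x: "x \<in> S" for x
    using sum_norm_le[of UNIV "\<lambda>i. d i x" "\<lambda>i. lam i x / sqrt m"] d_le[OF x]
    by (simp add: sum_divide_distrib)
  have lam_sum0: "0 \<le> (\<Sum>i\<in>UNIV. lam i x)" if "x \<in> S" for x
    by (rule sum_nonneg) (simp add: lam_nonneg S_dom that)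
  have C_ge: "0 \<le> C" "1 / sqrt m \<le> C"
    using C1 Q sm by (auto simp: C_def intro!: add_nonneg_nonneg)
  show thesis
  proof (rule that[OF C_ge(1)])
    fix x assume x: "x \<in> S"
    note xd = S_dom[OF x]
    have "dist x (trial x) \<le> (1 / sqrt m) * (\<Sum>i\<in>UNIV. lam i x)"
      using sum_d[OF x] by (simp add: trial_def dist_norm)
    also have "\<dots> \<le> C * (\<Sum>i\<in>UNIV. lam i x)" by (rule mult_right_mono[OF C_ge(2) lam_sum0[OF x]])
    finally show "dist x (trial x) \<le> C * (\<Sum>i\<in>UNIV. lam i x)" .
    have trial_dom: "sub i (trial x) \<in> edom (B i) (gs i)" for i
      unfolding sub_trial[OF xd] by (rule block_optimality_inequality(1)[OF xd xd])
    have G_trial: "fin G (trial x) = (\<Sum>i\<in>UNIV. fin (gs i) (sub i (trial x)))"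
      using G_real[OF trial_dom] by (simp add: fin_def)
    show "G (trial x) = ereal (fin G (trial x))" using G_real[OF trial_dom] G_trial by simp
    assume lam1: "\<And>i. lam i x \<le> 1"
    define z where "z i = sub i (xstar - x) - d i x" for i
    have z_norm: "local_norm f blk i x (z i) \<le> sqrt M * (R + 1 / sqrt m)" for i
    proof -
      have zB: "z i \<in> B i" unfolding z_def
        by (intro subspace_diff[OF subspace_block_space] direction_in_block[OF xd]) simp
      have "norm (z i) \<le> norm (sub i (xstar - x)) + norm (d i x)"
        unfolding z_def by (rule norm_triangle_ineq4)
      also have "\<dots> \<le> R + 1 / sqrt m"
      proof (rule add_mono)
        show "norm (sub i (xstar - x)) \<le> R"
          using norm_subvec_le[of blk i "xstar - x"] R[OF x] by (simp add: dist_norm)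
        show "norm (d i x) \<le> 1 / sqrt m"
          using d_le[OF x, of i] divide_right_mono[OF lam1[of i], of "sqrt m"] sm by linarith
      qed
      finally have nz: "norm (z i) \<le> R + 1 / sqrt m" .
      have "local_norm f blk i x (z i) \<le> sqrt (M * (norm (z i))\<^sup>2)"
        unfolding local_norm_eq[OF zB] by (rule real_sqrt_le_mono[OF HM[OF x]])
      also have "\<dots> = sqrt M * norm (z i)" by (simp add: real_sqrt_mult)
      also have "\<dots> \<le> sqrt M * (R + 1 / sqrt m)" using nz M by (intro mult_left_mono) auto
      finally show ?thesis .
    qed
    have "fin (gs i) (sub i (trial x)) \<le> fin (gs i) (sub i xstar) + grad (fin f) x \<bullet> z i + C1 * lam i x" for i
    proof -
      have "(\<eta> + 1) * lam i x * local_norm f blk i x (z i) \<le> (\<eta> + 1) * lam i x * (sqrt M * (R + 1 / sqrt m))"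
        using z_norm[of i] eta lam_nonneg[OF xd, of i] by (intro mult_left_mono) auto
      thus ?thesis
        using block_optimality_inequality(2)[OF xd S_dom[OF xstar_S], of i]
        unfolding sub_trial[OF xd] z_def[symmetric] by (simp add: C1_def algebra_simps)
    qed
    hence "fin G (trial x) \<le> (\<Sum>i\<in>UNIV. fin (gs i) (sub i xstar) + grad (fin f) x \<bullet> z i + C1 * lam i x)"
      unfolding G_trial by (intro sum_mono)
    also have "\<dots> = fin G xstar + grad (fin f) x \<bullet> (\<Sum>i\<in>UNIV. z i) + C1 * (\<Sum>i\<in>UNIV. lam i x)"
      by (simp add: sum.distrib F_real(3)[OF S_dom[OF xstar_S]] inner_sum_right sum_distrib_left)
    also have "(\<Sum>i\<in>UNIV. z i) = (xstar - x) - (\<Sum>i\<in>UNIV. d i x)"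
      by (simp add: z_def sum_subtractf sum_subvec)
    finally have G_le: "fin G (trial x) \<le> fin G xstar + grad (fin f) x \<bullet> (xstar - x)
        - grad (fin f) x \<bullet> (\<Sum>i\<in>UNIV. d i x) + C1 * (\<Sum>i\<in>UNIV. lam i x)"
      by (simp add: inner_diff_right)
    have f_le: "fin f x + grad (fin f) x \<bullet> (xstar - x) \<le> fin f xstar"
      by (rule self_concordant_gradient_inequality[OF f_sc]) (use S_dom_f x xstar_S in auto)
    have "- (grad (fin f) x \<bullet> (\<Sum>i\<in>UNIV. d i x)) \<le> norm (grad (fin f) x) * norm (\<Sum>i\<in>UNIV. d i x)"
      using Cauchy_Schwarz_ineq2[of "grad (fin f) x" "\<Sum>i\<in>UNIV. d i x"] by simp
    also have "\<dots> \<le> Q * ((\<Sum>i\<in>UNIV. lam i x) / sqrt m)"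
      using Q(2)[OF x] sum_d[OF x] Q(1) by (intro mult_mono) auto
    finally have "fin F x - fin F xstar \<le> fin G x - fin G (trial x) + (Q / sqrt m + C1) * (\<Sum>i\<in>UNIV. lam i x)"
      using G_le f_le F_real(2)[OF xd] F_real(2)[OF S_dom[OF xstar_S]] by (simp add: algebra_simps)
    also have "\<dots> \<le> fin G x - fin G (trial x) + C * (\<Sum>i\<in>UNIV. lam i x)"
      using sm lam_sum0[OF x] by (intro add_left_mono mult_right_mono) (auto simp: C_def)
    finally show "fin F x - fin F xstar \<le> fin G x - fin G (trial x) + C * (\<Sum>i\<in>UNIV. lam i x)" .
  qed
qed

text \<open>
  Half of \<open>\<epsilon>\<close> pays for \<open>g(x) - g(x + d(x))\<close>, the other half for the linear term.
\<close>
lemma small_directions_imp_small_gap: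
  assumes e: "0 < \<epsilon>"
  obtains \<Lambda> where "0 < \<Lambda>"
    "\<And>x. x \<in> S \<Longrightarrow> (\<And>i. lam i x \<le> \<Lambda>) \<Longrightarrow> fin F x - fin F xstar \<le> \<epsilon>"
proof -
  obtain C where C: "0 \<le> C"
    "\<And>x. x \<in> S \<Longrightarrow> dist x (trial x) \<le> C * (\<Sum>i\<in>UNIV. lam i x)"
    "\<And>x. x \<in> S \<Longrightarrow> G (trial x) = ereal (fin G (trial x))"
    "\<And>x. x \<in> S \<Longrightarrow> (\<And>i. lam i x \<le> 1) \<Longrightarrow>
       fin F x - fin F xstar \<le> fin G x - fin G (trial x) + C * (\<Sum>i\<in>UNIV. lam i x)"
    using gap_le_of_small_directions by metis
  obtain \<delta> where \<delta>: "0 < \<delta>" "\<And>x y. x \<in> S \<Longrightarrow> dist x y < \<delta> \<Longrightarrow> ereal (fin G x - \<epsilon> / 2) < G y"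
    using compact_lsc_uniform_lower_bound[OF compact_S continuous_on_fin_G F_real(4)[OF S_dom] G_lsc, of "\<epsilon> / 2"] e
    by (metis half_gt_zero)
  \<comment> \<open>The summand \<open>1\<close> keeps the divisor positive when \<open>C = 0\<close>.\<close>
  define c where "c = C * real CARD('b) + 1"
  define \<Lambda> where "\<Lambda> = min 1 (min (\<delta> / 2) (\<epsilon> / 2) / c)"
  have c: "0 < c" using C(1) by (simp add: c_def add_nonneg_pos)
  have \<Lambda>: "0 < \<Lambda>" "\<Lambda> \<le> 1" using e \<delta>(1) c by (auto simp: \<Lambda>_def)
  have c\<Lambda>: "c * \<Lambda> \<le> min (\<delta> / 2) (\<epsilon> / 2)"
  proof -
    have "\<Lambda> \<le> min (\<delta> / 2) (\<epsilon> / 2) / c" by (simp add: \<Lambda>_def)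
    thus ?thesis using c by (simp add: pos_le_divide_eq mult.commute)
  qed
  show thesis
  proof (rule that[OF \<Lambda>(1)])
    fix x assume x: "x \<in> S" and small: "\<And>i. lam i x \<le> \<Lambda>"
    have "(\<Sum>i\<in>UNIV. lam i x) \<le> real CARD('b) * \<Lambda>"
      using sum_bounded_above[of UNIV "\<lambda>i. lam i x" \<Lambda>] small by simp
    hence "C * (\<Sum>i\<in>UNIV. lam i x) \<le> C * (real CARD('b) * \<Lambda>)" using C(1) by (rule mult_left_mono)
    also have "\<dots> \<le> c * \<Lambda>" using \<Lambda> by (simp add: c_def algebra_simps)
    finally have sum_le: "C * (\<Sum>i\<in>UNIV. lam i x) \<le> min (\<delta> / 2) (\<epsilon> / 2)" using c\<Lambda> by simp
    hence "dist x (trial x) < \<delta>" using C(2)[OF x] \<delta>(1) by simp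
    hence "ereal (fin G x - \<epsilon> / 2) < ereal (fin G (trial x))"
      unfolding C(3)[OF x, symmetric] by (rule \<delta>(2)[OF x])
    moreover have "lam i x \<le> 1" for i using small[of i] \<Lambda> by simp
    ultimately show "fin F x - fin F xstar \<le> \<epsilon>" using C(4)[OF x] sum_le by simp
  qed
qed

definition min_decrease :: "'b \<Rightarrow> real^'n \<Rightarrow> real" where
  "min_decrease i x = (lam i x)\<^sup>2 / (4 * (1 + lam i x))"

lemma min_decrease_nonneg: "x \<in> S \<Longrightarrow> 0 \<le> min_decrease i x"
  using lam_nonneg[OF S_dom, of x i] by (simp add: min_decrease_def)

text \<open>
  Either all \<open>\<lambda>\<^sub>i(x)\<close> are small and the gap is at most \<open>\<epsilon>\<close>, or one of them
  exceeds a fixed \<open>\<Lambda>\<close>. In the second case the weighted sum is bounded away from zero, and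
  \<open>K\<close> is chosen so that its multiple is at least the gap at \<open>x0\<close>, the largest one on \<open>S\<close>.
\<close>
lemma gap_le_expected_decrease:
  assumes p: "\<And>i. 0 < p i" and e: "0 < \<epsilon>"
  obtains K where "0 \<le> K"
    "\<And>x. x \<in> S \<Longrightarrow> fin F x - fin F xstar \<le> \<epsilon> + K * (\<Sum>i\<in>UNIV. p i * min_decrease i x)"
proof -
  obtain \<Lambda> where \<Lambda>: "0 < \<Lambda>"
    "\<And>x. x \<in> S \<Longrightarrow> (\<And>i. lam i x \<le> \<Lambda>) \<Longrightarrow> fin F x - fin F xstar \<le> \<epsilon>"
    using small_directions_imp_small_gap[OF e] by metis
  define pm where "pm = Min (range p)"
  have pm: "0 < pm" "\<And>i. pm \<le> p i" using p by (auto simp: pm_def)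
  define h where "h = pm * (\<Lambda>\<^sup>2 / (4 * (1 + \<Lambda>)))"
  have h: "0 < h" using pm(1) \<Lambda>(1) by (simp add: h_def)
  define K where "K = (fin F x0 - fin F xstar) / h"
  have K: "0 \<le> K" using fin_F_xstar_le[OF x0_dom] h by (simp add: K_def)
  show thesis
  proof (rule that[OF K])
    fix x assume x: "x \<in> S"
    have nn: "0 \<le> p i * min_decrease i x" for i using less_imp_le[OF p[of i]] min_decrease_nonneg[OF x, of i] by simp
    show "fin F x - fin F xstar \<le> \<epsilon> + K * (\<Sum>i\<in>UNIV. p i * min_decrease i x)"
    proof (cases "\<forall>i. lam i x \<le> \<Lambda>")
      case True
      have "0 \<le> K * (\<Sum>i\<in>UNIV. p i * min_decrease i x)" by (intro mult_nonneg_nonneg K sum_nonneg nn)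
      thus ?thesis using \<Lambda>(2)[OF x] True by force
    next
      case False
      then obtain i where i: "\<Lambda> < lam i x" by (auto simp: not_le)
      have "h \<le> p i * min_decrease i x" unfolding h_def min_decrease_def
        using pm p decrement_mono[of \<Lambda> "lam i x"] \<Lambda>(1) i by (intro mult_mono) (auto intro: less_imp_le)
      also have "\<dots> \<le> (\<Sum>i\<in>UNIV. p i * min_decrease i x)"
        by (rule member_le_sum) (use nn in auto)
      finally have "K * h \<le> K * (\<Sum>i\<in>UNIV. p i * min_decrease i x)" using K by (rule mult_left_mono)
      moreover have "K * h = fin F x0 - fin F xstar" using h by (simp add: K_def)
      ultimately show ?thesis using x e by (simp add: S_iff)
    qed
  qed
qed

end

section \<open>The random process\<close>

lemma ereal_expectation_eq_integral:
  assumes "integrable M Y"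
  shows "ereal_expectation M (\<lambda>\<omega>. ereal (Y \<omega>)) = ereal (\<integral>\<omega>. Y \<omega> \<partial>M)"
proof -
  obtain u v where "0 \<le> u" "0 \<le> v" "(\<integral>\<^sup>+ \<omega>. ennreal (Y \<omega>) \<partial>M) = ennreal u"
    "(\<integral>\<^sup>+ \<omega>. ennreal (- Y \<omega>) \<partial>M) = ennreal v" "integral\<^sup>L M Y = u - v"
    by (rule integrableE[OF assms])
  thus ?thesis by (simp add: ereal_expectation_def)
qed

text \<open>
  The sequence converges, so its consecutive differences tend to zero; in the limit the gap is at
  most \<open>\<epsilon>\<close>.
\<close>
lemma tendsto_of_gap_le_decrease:
  fixes a :: "nat \<Rightarrow> real"
  assumes lb: "\<And>k. L \<le> a k" and dec: "\<And>k. a (Suc k) \<le> a k"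
    and gap: "\<And>\<epsilon>. 0 < \<epsilon> \<Longrightarrow> \<exists>K. \<forall>k. a k - L \<le> \<epsilon> + K * (a k - a (Suc k))"
  shows "a \<longlonglongrightarrow> L"
proof -
  obtain A where A: "a \<longlonglongrightarrow> A"
    using decseq_convergent[OF decseq_SucI[of a, OF dec], of L] lb by blast
  have "A \<le> L"
  proof (rule field_le_epsilon)
    fix \<epsilon> :: real assume e: "0 < \<epsilon>"
    obtain K where K: "\<And>k. a k - L \<le> \<epsilon> + K * (a k - a (Suc k))" using gap[OF e] by blast
    have "(\<lambda>k. \<epsilon> + K * (a k - a (Suc k))) \<longlonglongrightarrow> \<epsilon> + K * (A - A)"
      by (intro tendsto_intros A LIMSEQ_Suc)
    moreover have "(\<lambda>k. a k - L) \<longlonglongrightarrow> A - L" by (intro tendsto_intros A)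
    ultimately have "A - L \<le> \<epsilon> + K * (A - A)" using K by (intro LIMSEQ_le) auto
    thus "A \<le> L + \<epsilon>" by simp
  qed
  moreover have "L \<le> A" using A lb by (intro LIMSEQ_le_const) auto
  ultimately show ?thesis using A by simp
qed

lemma rbpdn_cong:
  "(\<And>l. l < k \<Longrightarrow> c l = c' l) \<Longrightarrow> rbpdn f blk d x0 c k = rbpdn f blk d x0 c' k"
  by (induction k) auto

text \<open>
  Even measurability with respect to all subsets of the state space holds, because the iterate
  is determined by finitely many choices from a finite set. The source of the choices is
  arbitrary, so that the lemma covers the probability space as well as the product space of
  past choices.
\<close>
lemma measurable_rbpdn:
  fixes c :: "'w \<Rightarrow> nat \<Rightarrow> 'b::finite"
  assumes "\<And>l. l < k \<Longrightarrow> (\<lambda>\<omega>. c \<omega> l) \<in> N \<rightarrow>\<^sub>M count_space UNIV"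
  shows "(\<lambda>\<omega>. rbpdn f blk d x0 (c \<omega>) k) \<in> N \<rightarrow>\<^sub>M count_space UNIV"
  using assms
proof (induction k)
  case (Suc k)
  hence IH: "(\<lambda>\<omega>. rbpdn f blk d x0 (c \<omega>) k) \<in> N \<rightarrow>\<^sub>M count_space UNIV" by simp
  have "(\<lambda>\<omega>. rbpdn_step f blk d i (rbpdn f blk d x0 (c \<omega>) k)) \<in> N \<rightarrow>\<^sub>M count_space UNIV" for i
    by (rule measurable_compose[OF IH]) simp
  thus ?case unfolding rbpdn.simps
    by (rule measurable_compose_countable) (use Suc in simp)
qed simp

locale rbpdn_process = rbpdn_problem f blk gs d x0 \<eta> F + prob_space M
  for f :: "real^'n \<Rightarrow> ereal"
    and blk :: "'n \<Rightarrow> 'b::finite"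
    and gs :: "'b \<Rightarrow> real^'n \<Rightarrow> ereal"
    and d :: "'b \<Rightarrow> real^'n \<Rightarrow> real^'n"
    and x0 :: "real^'n"
    and \<eta> :: real
    and F :: "real^'n \<Rightarrow> ereal"
    and M :: "'w measure" +
  fixes p :: "'b \<Rightarrow> real"
    and \<iota> :: "nat \<Rightarrow> 'w \<Rightarrow> 'b"
  assumes p_pos: "\<And>i. 0 < p i"
    and choice_indep: "indep_vars (\<lambda>_. count_space UNIV) \<iota> UNIV"
    and choice_prob: "\<And>k i. prob {\<omega> \<in> space M. \<iota> k \<omega> = i} = p i"
begin

definition X :: "nat \<Rightarrow> 'w \<Rightarrow> real^'n" where
  "X k \<omega> = rbpdn f blk d x0 (\<lambda>l. \<iota> l \<omega>) k"

lemma X_in_S: "X k \<omega> \<in> S"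
  by (induction k) (auto simp: X_def x0_S step_in_S)

lemma choice_measurable: "\<iota> k \<in> M \<rightarrow>\<^sub>M count_space UNIV"
  using choice_indep by (simp add: indep_vars_def)

lemma X_measurable: "X k \<in> M \<rightarrow>\<^sub>M count_space UNIV"
  unfolding X_def[abs_def] by (intro measurable_rbpdn choice_measurable)

lemma integrable_X:
  assumes "\<And>x. x \<in> S \<Longrightarrow> \<bar>h x\<bar> \<le> b"
  shows "integrable M (\<lambda>\<omega>. h (X k \<omega>) :: real)"
proof (rule integrable_const_bound)
  show "AE \<omega> in M. norm (h (X k \<omega>)) \<le> b" using assms[OF X_in_S] by simp
  show "(\<lambda>\<omega>. h (X k \<omega>)) \<in> borel_measurable M" by (rule measurable_compose[OF X_measurable]) simp
qed

text \<open>
  The iterate is a function of the choices before iteration \<open>k\<close>, hence independent of the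
  choice made at iteration \<open>k\<close>.
\<close>
lemma expectation_at_chosen_block:
  assumes bd: "\<And>x. x \<in> S \<Longrightarrow> \<bar>h x\<bar> \<le> b"
  shows "integrable M (\<lambda>\<omega>. h (X k \<omega>) * indicator {i} (\<iota> k \<omega>))"
    and "expectation (\<lambda>\<omega>. h (X k \<omega>) * indicator {i} (\<iota> k \<omega>)) = p i * expectation (\<lambda>\<omega>. h (X k \<omega>))"
proof -
  let ?P = "\<lambda>A. PiM A (\<lambda>_::nat. count_space (UNIV :: 'b set))"
  let ?past = "\<lambda>\<omega>. restrict (\<lambda>l. \<iota> l \<omega>) {..<k}" and ?now = "\<lambda>\<omega>. restrict (\<lambda>l. \<iota> l \<omega>) {k}"
  let ?Y1 = "\<lambda>c. h (rbpdn f blk d x0 c k)" and ?Y2 = "\<lambda>c. indicator {i} (c k) :: real"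
  have "indep_var (?P {..<k}) ?past (?P {k}) ?now"
    by (rule indep_var_restrict[OF choice_indep]) auto
  moreover have "?Y1 \<in> ?P {..<k} \<rightarrow>\<^sub>M borel"
    by (rule measurable_compose[OF measurable_rbpdn[of k "\<lambda>c. c"]])
      (auto intro: measurable_component_singleton)
  moreover have "?Y2 \<in> ?P {k} \<rightarrow>\<^sub>M borel"
    by (rule measurable_compose[OF measurable_component_singleton[of k "{k}"]]) auto
  ultimately have "indep_var borel (?Y1 \<circ> ?past) borel (?Y2 \<circ> ?now)" by (rule indep_var_compose)
  moreover have "?Y1 \<circ> ?past = (\<lambda>\<omega>. h (X k \<omega>))"
    unfolding X_def o_def by (intro ext arg_cong[of _ _ h] rbpdn_cong) simp
  moreover have "?Y2 \<circ> ?now = (\<lambda>\<omega>. indicator {i} (\<iota> k \<omega>))" by (simp add: o_def)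
  ultimately have indep: "indep_var borel (\<lambda>\<omega>. h (X k \<omega>)) borel (\<lambda>\<omega>. indicator {i} (\<iota> k \<omega>) :: real)" by simp
  have meas: "{\<omega> \<in> space M. \<iota> k \<omega> = i} \<in> sets M"
    using measurable_sets[OF choice_measurable, of "{i}" k] by (simp add: vimage_def Int_def conj_commute)
  have int2: "integrable M (\<lambda>\<omega>. indicator {i} (\<iota> k \<omega>) :: real)"
    by (rule integrable_const_bound[of _ 1])
      (auto intro!: measurable_compose[OF choice_measurable] simp: indicator_def)
  have "expectation (\<lambda>\<omega>. indicator {i} (\<iota> k \<omega>)) = expectation (indicator {\<omega> \<in> space M. \<iota> k \<omega> = i})"
    by (rule Bochner_Integration.integral_cong) (auto simp: indicator_def)
  also have "\<dots> = p i" using meas choice_prob[of k i] by simp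
  finally have e2: "expectation (\<lambda>\<omega>. indicator {i} (\<iota> k \<omega>)) = p i" .
  show "integrable M (\<lambda>\<omega>. h (X k \<omega>) * indicator {i} (\<iota> k \<omega>))"
    by (rule indep_var_integrable[OF indep integrable_X[OF bd] int2])
  show "expectation (\<lambda>\<omega>. h (X k \<omega>) * indicator {i} (\<iota> k \<omega>)) = p i * expectation (\<lambda>\<omega>. h (X k \<omega>))"
    by (subst indep_var_lebesgue_integral[OF indep integrable_X[OF bd] int2]) (simp_all add: e2)
qed

lemma fin_F_bounded: "x \<in> S \<Longrightarrow> \<bar>fin F x\<bar> \<le> \<bar>fin F x0\<bar> + \<bar>fin F xstar\<bar>"
  using fin_F_xstar_le[of x] by (auto simp: S_iff)

lemma min_decrease_bounded: "x \<in> S \<Longrightarrow> \<bar>min_decrease i x\<bar> \<le> fin F x0 - fin F xstar"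
  using min_decrease_nonneg[of x i] step_decrease(2)[OF S_dom, of x i, folded min_decrease_def]
    fin_F_xstar_le[OF S_dom[OF step_in_S], of x i]
  by (simp add: S_iff)

text \<open>
  Pathwise, the decrease is at least the guaranteed one of the chosen block, written as a sum over
  all blocks with indicators so that independence applies to each term.
\<close>
lemma expected_decrease:
  "expectation (\<lambda>\<omega>. fin F (X (Suc k) \<omega>))
    \<le> expectation (\<lambda>\<omega>. fin F (X k \<omega>)) - expectation (\<lambda>\<omega>. \<Sum>i\<in>UNIV. p i * min_decrease i (X k \<omega>))"
proof -
  note int_F = integrable_X[of "fin F", OF fin_F_bounded]
  note int_dec = integrable_X[of "min_decrease i" for i, OF min_decrease_bounded]
  note chosen = expectation_at_chosen_block[of "min_decrease i" for i, OF min_decrease_bounded]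
  let ?D = "\<lambda>\<omega>. \<Sum>i\<in>UNIV. min_decrease i (X k \<omega>) * indicator {i} (\<iota> k \<omega>)"
  have "expectation (\<lambda>\<omega>. fin F (X (Suc k) \<omega>)) \<le> expectation (\<lambda>\<omega>. fin F (X k \<omega>) - ?D \<omega>)"
  proof (rule integral_mono)
    show "integrable M (\<lambda>\<omega>. fin F (X (Suc k) \<omega>))" by (rule int_F)
    show "integrable M (\<lambda>\<omega>. fin F (X k \<omega>) - ?D \<omega>)"
      by (intro Bochner_Integration.integrable_diff Bochner_Integration.integrable_sum int_F chosen(1))
    fix \<omega>
    have "?D \<omega> = (\<Sum>i\<in>UNIV. if i = \<iota> k \<omega> then min_decrease i (X k \<omega>) else 0)"
      by (rule sum.cong) (auto simp: indicator_def)
    hence "?D \<omega> = min_decrease (\<iota> k \<omega>) (X k \<omega>)" by simp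
    moreover have "X (Suc k) \<omega> = rbpdn_step f blk d (\<iota> k \<omega>) (X k \<omega>)" by (simp add: X_def)
    ultimately show "fin F (X (Suc k) \<omega>) \<le> fin F (X k \<omega>) - ?D \<omega>"
      using step_decrease(2)[OF S_dom[OF X_in_S[of k \<omega>]], of "\<iota> k \<omega>"] by (simp add: min_decrease_def)
  qed
  also have "\<dots> = expectation (\<lambda>\<omega>. fin F (X k \<omega>)) - expectation ?D"
    by (intro Bochner_Integration.integral_diff Bochner_Integration.integrable_sum int_F chosen(1))
  also have "expectation ?D = (\<Sum>i\<in>UNIV. p i * expectation (\<lambda>\<omega>. min_decrease i (X k \<omega>)))"
    by (subst Bochner_Integration.integral_sum) (auto intro: chosen simp: chosen)
  also have "\<dots> = expectation (\<lambda>\<omega>. \<Sum>i\<in>UNIV. p i * min_decrease i (X k \<omega>))"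
    by (subst Bochner_Integration.integral_sum) (auto intro: int_dec)
  finally show ?thesis .
qed

lemma expectation_tendsto:
  "(\<lambda>k. expectation (\<lambda>\<omega>. fin F (X k \<omega>))) \<longlonglongrightarrow> fin F xstar"
proof (rule tendsto_of_gap_le_decrease)
  note int_F = integrable_X[of "fin F", OF fin_F_bounded]
  fix k
  have "expectation (\<lambda>\<omega>. fin F xstar) \<le> expectation (\<lambda>\<omega>. fin F (X k \<omega>))"
    by (intro integral_mono int_F fin_F_xstar_le S_dom X_in_S) simp
  thus "fin F xstar \<le> expectation (\<lambda>\<omega>. fin F (X k \<omega>))" by (simp add: prob_space)
  have "0 \<le> (\<Sum>i\<in>UNIV. p i * min_decrease i (X k \<omega>))" for \<omega>
    by (intro sum_nonneg mult_nonneg_nonneg min_decrease_nonneg X_in_S) (simp add: less_imp_le p_pos)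
  hence "0 \<le> expectation (\<lambda>\<omega>. \<Sum>i\<in>UNIV. p i * min_decrease i (X k \<omega>))"
    by (intro Bochner_Integration.integral_nonneg)
  thus "expectation (\<lambda>\<omega>. fin F (X (Suc k) \<omega>)) \<le> expectation (\<lambda>\<omega>. fin F (X k \<omega>))"
    using expected_decrease[of k] by simp
next
  note int_F = integrable_X[of "fin F", OF fin_F_bounded]
  note int_dec = integrable_X[of "min_decrease i" for i, OF min_decrease_bounded]
  have int_sum: "integrable M (\<lambda>\<omega>. \<Sum>i\<in>UNIV. p i * min_decrease i (X k \<omega>))" for k
    by (intro Bochner_Integration.integrable_sum integrable_mult_right int_dec)
  fix \<epsilon> :: real assume "0 < \<epsilon>"
  then obtain K where K: "0 \<le> K"
    "\<And>x. x \<in> S \<Longrightarrow> fin F x - fin F xstar \<le> \<epsilon> + K * (\<Sum>i\<in>UNIV. p i * min_decrease i x)"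
    using gap_le_expected_decrease[of p \<epsilon>] p_pos by blast
  have "expectation (\<lambda>\<omega>. fin F (X k \<omega>)) - fin F xstar
      \<le> \<epsilon> + K * (expectation (\<lambda>\<omega>. fin F (X k \<omega>)) - expectation (\<lambda>\<omega>. fin F (X (Suc k) \<omega>)))" for k
  proof -
    have "expectation (\<lambda>\<omega>. fin F (X k \<omega>) - fin F xstar)
        \<le> expectation (\<lambda>\<omega>. \<epsilon> + K * (\<Sum>i\<in>UNIV. p i * min_decrease i (X k \<omega>)))"
      by (intro integral_mono Bochner_Integration.integrable_diff Bochner_Integration.integrable_add
          integrable_mult_right int_F int_sum K(2) X_in_S) auto
    hence "expectation (\<lambda>\<omega>. fin F (X k \<omega>)) - fin F xstar
        \<le> \<epsilon> + K * expectation (\<lambda>\<omega>. \<Sum>i\<in>UNIV. p i * min_decrease i (X k \<omega>))"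
      by (simp add: int_F int_sum prob_space)
    also have "\<dots> \<le> \<epsilon> + K * (expectation (\<lambda>\<omega>. fin F (X k \<omega>)) - expectation (\<lambda>\<omega>. fin F (X (Suc k) \<omega>)))"
      using expected_decrease[of k] K(1) by (intro add_left_mono mult_left_mono) auto
    finally show ?thesis .
  qed
  thus "\<exists>K. \<forall>k. expectation (\<lambda>\<omega>. fin F (X k \<omega>)) - fin F xstar
      \<le> \<epsilon> + K * (expectation (\<lambda>\<omega>. fin F (X k \<omega>)) - expectation (\<lambda>\<omega>. fin F (X (Suc k) \<omega>)))" by blast
qed

text \<open>
  The iterates stay in the sublevel set, where \<open>F\<close> is finite and bounded, so the
  extended-valued expectation is an ordinary integral.
\<close>
lemma ereal_expectation_tendsto:
  "(\<lambda>k. ereal_expectation M (\<lambda>\<omega>. F (rbpdn f blk d x0 (\<lambda>l. \<iota> l \<omega>) k))) \<longlonglongrightarrow> (INF x. F x)"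
proof -
  have "(\<lambda>\<omega>. F (rbpdn f blk d x0 (\<lambda>l. \<iota> l \<omega>) k)) = (\<lambda>\<omega>. ereal (fin F (X k \<omega>)))" for k
    using F_real(1)[OF S_dom[OF X_in_S[of k]]] unfolding X_def by (intro ext)
  hence "ereal_expectation M (\<lambda>\<omega>. F (rbpdn f blk d x0 (\<lambda>l. \<iota> l \<omega>) k))
      = ereal (expectation (\<lambda>\<omega>. fin F (X k \<omega>)))" for k
    using ereal_expectation_eq_integral[OF integrable_X[of "fin F", OF fin_F_bounded], of k] by simp
  moreover have "(INF x. F x) = ereal (fin F xstar)"
    unfolding F_real(1)[OF S_dom[OF xstar_S], symmetric]
    by (rule antisym[OF INF_lower INF_greatest]) (auto simp: F_xstar_le)
  ultimately show ?thesis using expectation_tendsto by simp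
qed

end

theorem theorem4p1:
  fixes f :: "real^'n \<Rightarrow> ereal"
    and blk :: "'n \<Rightarrow> 'b::finite"
    and gs :: "'b \<Rightarrow> real^'n \<Rightarrow> ereal"
    and d :: "'b \<Rightarrow> real^'n \<Rightarrow> real^'n"
    and x0 :: "real^'n"
    and \<eta> :: real
    and p :: "'b \<Rightarrow> real"
    and M :: "'w measure"
    and \<iota> :: "nat \<Rightarrow> 'w \<Rightarrow> 'b"
  defines "F \<equiv> objective f blk gs"
  assumes "\<And>i. proper_on (block_space blk i) (gs i)"
    and "\<And>i. closed_convex_on (block_space blk i) (gs i)"
    and "standard_self_concordant f"
    and "continuous_on (edom UNIV F) (hess (fin f))"
    and "\<And>x. x \<in> edom UNIV F \<Longrightarrow> pos_def (hess (fin f) x)"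
    and "\<exists>!x. is_arg_min F (\<lambda>_. True) x"
    and "x0 \<in> edom UNIV F"
    and "0 \<le> \<eta>" and "\<eta> \<le> 1/4"
    and "\<And>i. 0 < p i" and "(\<Sum>i\<in>UNIV. p i) = 1"
    and "\<And>x i. x \<in> edom UNIV F \<Longrightarrow> approx_direction f blk gs \<eta> i x (d i x)"
    and "prob_space M"
    and "prob_space.indep_vars M (\<lambda>_. count_space UNIV) \<iota> UNIV"
    and "\<And>k i. measure M {\<omega> \<in> space M. \<iota> k \<omega> = i} = p i"
    and "\<exists>L. L-lipschitz_on {x. F x \<le> F x0} (fin (block_sep blk gs))"
  shows "(\<lambda>k. ereal_expectation M (\<lambda>\<omega>. F (rbpdn f blk d x0 (\<lambda>l. \<iota> l \<omega>) k)))
           \<longlonglongrightarrow> (INF x. F x)"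
proof -
  interpret prob_space M by fact
  interpret rbpdn_process f blk gs d x0 \<eta> F M p \<iota>
    by unfold_locales (use assms in auto)
  show ?thesis by (rule ereal_expectation_tendsto)
qed

end
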